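(* For every integer $m\geq 2$ there exists a $(2m+2,\check{M}_{2m+2},\mathcal{K})$-snake with \[\check{M}_{2m+2}=\frac{2m}{2m+2}\cdot\frac{(2m+2)!}{2}-(2m-2)\,2m.\]
   Context: $S_n$ is the group of permutations of $[n]=\{1,\dots,n\}$ under composition; vector notation $\sigma=[\sigma(1),\dots,\sigma(n)]$. For $1<j\leq n$, the push-to-the-top transition is $t_{\uparrow j}([a_1,\dots,a_n])=[a_j,a_1,\dots,a_{j-1},a_{j+1},\dots,a_n]$. A $G_\uparrow(n,M)$ is a sequence $(c_1,\dots,c_M)$ of pairwise distinct elements of $S_n$ such that for every $r\in[M]$ there is $1<j_r\leq n$ with $c_{(r\bmod M)+1}=t_{\uparrow j_r}(c_r)$ (a cyclic push-to-the-top Gray code). The Kendall $\tau$-metric $d_{\mathcal K}(\sigma,\tau)=|\{(i,j):\sigma(i)<\sigma(j),\ \tau(i)>\tau(j)\}|$ is described in terms of adjacent transpositions as follows: it is the minimal $r$ such that $\sigma=\tau\circ(i_1,i_1+1)\circ\cdots\circ(i_r,i_r+1)$ for some $i_1,\dots,i_r\in[n-1]$. An $(n,M,\mathcal K)$-snake is a $G_\uparrow(n,M)$ code $C$ such that $d_{\mathcal K}(\sigma,\tau)\geq 2$ for all distinct $\sigma,\tau\in C$; equivalently, there are no $\sigma,\tau\in C$ and $i\in[n-1]$ with $\sigma=\tau\circ(i,i+1)$. *)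

theory Defs
  imports Complex_Main "HOL-Combinatorics.Permutations"
begin

text \<open>
  The group \<open>S\<^sub>n\<close> consists of the functions \<open>\<sigma>\<close> with \<open>\<sigma> permutes {1..n}\<close> (in particular, \<open>\<sigma>\<close> is the
  identity outside \<open>{1..n}\<close>), and the vector notation of \<open>\<sigma>\<close> is \<open>[\<sigma> 1, \<dots>, \<sigma> n]\<close>.
\<close>

definition push_top :: "nat \<Rightarrow> (nat \<Rightarrow> nat) \<Rightarrow> (nat \<Rightarrow> nat)" where
  "push_top j a = (\<lambda>i. if i = 1 then a j else if 1 < i \<and> i \<le> j then a (i - 1) else a i)"

text \<open>Only the values \<open>c 1, \<dots>, c M\<close> are meaningful.\<close>

definition push_top_gray_code :: "nat \<Rightarrow> nat \<Rightarrow> (nat \<Rightarrow> nat \<Rightarrow> nat) \<Rightarrow> bool" where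
  "push_top_gray_code n M c \<longleftrightarrow>
     (\<forall>r\<in>{1..M}. c r permutes {1..n}) \<and>
     inj_on c {1..M} \<and>
     (\<forall>r\<in>{1..M}. \<exists>j. 1 < j \<and> j \<le> n \<and> c (r mod M + 1) = push_top j (c r))"

text \<open>
  \<open>adj_word \<tau> [i\<^sub>1, \<dots>, i\<^sub>r]\<close> is \<open>\<tau> \<circ> (i\<^sub>1, i\<^sub>1 + 1) \<circ> \<dots> \<circ> (i\<^sub>r, i\<^sub>r + 1)\<close>; since the transpositions are
  composed on the right, they exchange entries in adjacent positions of the vector notation.
\<close>

definition adj_word :: "(nat \<Rightarrow> nat) \<Rightarrow> nat list \<Rightarrow> (nat \<Rightarrow> nat)" where
  "adj_word \<tau> is = foldl (\<lambda>\<rho> i. \<rho> \<circ> transpose i (i + 1)) \<tau> is"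

text \<open>
  The index set \<open>[n - 1]\<close> is \<open>{1..<n}\<close>. For \<open>\<sigma>, \<tau> \<in> S\<^sub>n\<close> the minimum is over a nonempty set
  (lemma \<open>adj_word_exists\<close>). It is the number of pairs of symbols whose relative order in the two
  vectors differs, i.e. the number of inversions between the position functions \<open>inv \<sigma>\<close> and
  \<open>inv \<tau>\<close>.
\<close>

definition kendall_dist :: "nat \<Rightarrow> (nat \<Rightarrow> nat) \<Rightarrow> (nat \<Rightarrow> nat) \<Rightarrow> nat" where
  "kendall_dist n \<sigma> \<tau> =
     (LEAST r. \<exists>is. length is = r \<and> set is \<subseteq> {1..<n} \<and> \<sigma> = adj_word \<tau> is)"

definition kendall_snake :: "nat \<Rightarrow> nat \<Rightarrow> (nat \<Rightarrow> nat \<Rightarrow> nat) \<Rightarrow> bool" where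
  "kendall_snake n M c \<longleftrightarrow>
     push_top_gray_code n M c \<and>
     (\<forall>\<sigma>\<in>c ` {1..M}. \<forall>\<tau>\<in>c ` {1..M}. \<sigma> \<noteq> \<tau> \<longrightarrow> kendall_dist n \<sigma> \<tau> \<ge> 2)"

lemma push_top_vector:
  assumes "1 \<le> j" "j \<le> n"
  shows "map (push_top j a) [1..<n + 1] =
         a j # map a [1..<j] @ map a [j + 1..<n + 1]"
proof (rule nth_equalityI)
  show "length (map (push_top j a) [1..<n + 1]) =
        length (a j # map a [1..<j] @ map a [j + 1..<n + 1])"
    using assms by simp
next
  fix i assume "i < length (map (push_top j a) [1..<n + 1])"
  then show "map (push_top j a) [1..<n + 1] ! i =
             (a j # map a [1..<j] @ map a [j + 1..<n + 1]) ! i"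
    using assms by (cases i) (auto simp: push_top_def nth_append simp del: upt_Suc)
qed

lemma adj_word_append: "adj_word \<tau> (is @ js) = adj_word (adj_word \<tau> is) js"
  by (simp add: adj_word_def)

lemma adj_word_comp: "adj_word \<tau> is = \<tau> \<circ> adj_word id is"
  by (induction "is" rule: rev_induct) (auto simp: adj_word_def o_assoc)

lemma transpose_adj_word:
  assumes "1 \<le> a" "a < b" "b \<le> n"
  shows "\<exists>is. set is \<subseteq> {1..<n} \<and> transpose a b = adj_word id is"
  using assms
proof (induction "b - a" arbitrary: b)
  case 0
  then show ?case by simp
next
  case (Suc d)
  show ?case
  proof (cases "b = a + 1")
    case True
    then show ?thesis
      using Suc.prems by (intro exI[of _ "[a]"]) (auto simp: adj_word_def)
  next
    case False
    define k where "k = b - 1"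
    have k: "b = k + 1" "a < k" "k < n"
      using Suc.prems False by (auto simp: k_def)
    have "d = k - a" using Suc.hyps(2) k by simp
    then obtain ks where ks: "set ks \<subseteq> {1..<n}" "transpose a k = adj_word id ks"
      using Suc.hyps(1)[of k] Suc.prems k by auto
    have "transpose a b = transpose k b \<circ> transpose a k \<circ> transpose k b"
      using k by (auto simp: fun_eq_iff transpose_def)
    also have "\<dots> = adj_word id ([k] @ ks @ [k])"
      unfolding adj_word_append using ks(2) k(1)
      by (subst adj_word_comp[of _ ks]) (simp add: adj_word_def)
    finally show ?thesis
      using ks(1) k Suc.prems by (intro exI[of _ "[k] @ ks @ [k]"]) auto
  qed
qed

lemma permutes_adj_word:
  assumes "p permutes {1..n}"
  shows "\<exists>is. set is \<subseteq> {1..<n} \<and> p = adj_word id is"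
  using finite_atLeastAtMost assms
proof (induction rule: permutes_rev_induct)
  case id
  show ?case by (intro exI[of _ "[]"]) (simp add: adj_word_def)
next
  case (swap a b p)
  then obtain ps where ps: "set ps \<subseteq> {1..<n}" "p = adj_word id ps" by blast
  have "\<exists>is. set is \<subseteq> {1..<n} \<and> transpose a b = adj_word id is"
  proof (cases "a < b")
    case True
    then show ?thesis using transpose_adj_word[of a b n] swap by auto
  next
    case False
    then show ?thesis
      using transpose_adj_word[of b a n] swap by (auto simp: transpose_commute)
  qed
  then obtain ts where "set ts \<subseteq> {1..<n}" "transpose a b = adj_word id ts" by blast
  then have "p \<circ> transpose a b = adj_word id (ps @ ts)" "set (ps @ ts) \<subseteq> {1..<n}"
    using ps adj_word_comp[of p ts] by (simp_all only: adj_word_append set_append Un_subset_iff)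
  then show ?case by blast
qed

lemma adj_word_exists:
  assumes "\<sigma> permutes {1..n}" "\<tau> permutes {1..n}"
  shows "\<exists>is. set is \<subseteq> {1..<n} \<and> \<sigma> = adj_word \<tau> is"
proof -
  have "inv \<tau> \<circ> \<sigma> permutes {1..n}"
    using assms by (intro permutes_compose permutes_inv)
  then obtain ws where "set ws \<subseteq> {1..<n}" "inv \<tau> \<circ> \<sigma> = adj_word id ws"
    using permutes_adj_word by blast
  moreover have "\<tau> \<circ> (inv \<tau> \<circ> \<sigma>) = \<sigma>"
    using permutes_inv_o(1)[OF assms(2)] by (simp add: o_assoc)
  ultimately show ?thesis using adj_word_comp[of \<tau> ws] by auto
qed

lemma kendall_dist_ge_2_iff:
  assumes "\<sigma> permutes {1..n}" "\<tau> permutes {1..n}" "\<sigma> \<noteq> \<tau>"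
  shows "kendall_dist n \<sigma> \<tau> \<ge> 2 \<longleftrightarrow> (\<forall>i\<in>{1..<n}. \<sigma> \<noteq> \<tau> \<circ> transpose i (i + 1))"
proof
  assume ge: "kendall_dist n \<sigma> \<tau> \<ge> 2"
  show "\<forall>i\<in>{1..<n}. \<sigma> \<noteq> \<tau> \<circ> transpose i (i + 1)"
  proof (intro ballI notI)
    fix i assume i: "i \<in> {1..<n}" "\<sigma> = \<tau> \<circ> transpose i (i + 1)"
    have "kendall_dist n \<sigma> \<tau> \<le> 1"
      unfolding kendall_dist_def
      by (rule Least_le, rule exI[of _ "[i]"]) (use i in \<open>auto simp: adj_word_def\<close>)
    with ge show False by simp
  qed
next
  assume no: "\<forall>i\<in>{1..<n}. \<sigma> \<noteq> \<tau> \<circ> transpose i (i + 1)"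
  have "\<exists>is. length is = kendall_dist n \<sigma> \<tau> \<and> set is \<subseteq> {1..<n} \<and> \<sigma> = adj_word \<tau> is"
    unfolding kendall_dist_def
    by (rule LeastI_ex) (use adj_word_exists[OF assms(1,2)] in auto)
  then obtain ws where ws: "length ws = kendall_dist n \<sigma> \<tau>" "set ws \<subseteq> {1..<n}"
    "\<sigma> = adj_word \<tau> ws" by blast
  show "kendall_dist n \<sigma> \<tau> \<ge> 2"
  proof (cases ws)
    case Nil
    then show ?thesis using ws(3) assms(3) by (simp add: adj_word_def)
  next
    case (Cons i vs)
    then show ?thesis using ws no by (cases vs) (auto simp: adj_word_def)
  qed
qed

end

theory Submission
  imports Defs "HOL-Combinatorics.Multiset_Permutations"
begin

text \<open>
  Write \<open>n = 2m + 1\<close>, and let \<open>T\<close> and \<open>U\<close> be the transitions of length \<open>n\<close> and \<open>n - 2\<close>; both are even.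
  The code visits \<open>2m\<close> cells. Within a cell the last symbol is fixed and the code runs through all even
  permutations except a single \<open>U\<close>-orbit of size \<open>n - 2\<close>, namely the one containing \<open>T\<inverse>\<close> of the first
  word; the last word is \<open>U\<inverse>\<close> of the first one. Two transitions of length \<open>n + 1\<close>, with one odd
  permutation in between, lead to the next cell. The odd permutations end with one of two symbols
  that label no cell, so the only even permutation of the cells that is adjacent to such an odd one
  is \<open>T\<inverse>\<close> of the first word of the next cell, which is omitted.

  The path in a cell comes from the \<open>T\<close>-orbits, which are the cyclic words. Replacing \<open>T\<close> by \<open>U\<close> on
  three words that differ by a rotation of their last three letters merges the three orbits into
  one. A seed of \<open>2(n - 2)\<close> orbits, with all three-letter rotations that meet the omitted orbit,
  yields the omitted orbit and one further cycle, and the remaining orbits are attached in pairs: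
  cutting the cyclic words at a fixed letter turns this into the growth of a set of linear words.
\<close>

section \<open>Parity of words and growth of sets of words\<close>

text \<open>\<open>T\<close> and \<open>U\<close> are even and adjacent transpositions are odd, so
  the even permutations never conflict with one another. The price is that only the transition of
  length \<open>n + 1\<close>, which is odd, changes the last symbol; this forces two such
  transitions at each change of cell. Renaming symbols commutes with all transitions, so a single
  path suffices: if \<open>h\<close> is the permutation that begins the second cell, the cells are
  the left translates of the first one by the powers of \<open>h\<close>. With the identity as first
  word and its \<open>U\<close>-preimage as last word, \<open>h\<close> is the product of the
  transposition of \<open>1\<close> and \<open>n\<close> with a cycle of length \<open>2m\<close> on
  the remaining symbols. Thus \<open>h\<close> has order \<open>2m\<close>, the code closes after
  \<open>2m\<close> cells, and \<open>1\<close> and \<open>n\<close> are the two symbols that label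
  no cell. Every cell contributes \<open>n!/2 - (n - 2)\<close> even permutations and one odd one,
  which gives the count claimed.\<close>

fun ipar :: "nat list \<Rightarrow> bool" where
  "ipar [] = True"
| "ipar (x # xs) = (even (length (filter (\<lambda>y. y < x) xs)) = ipar xs)"

lemma ipar_swap:
  assumes "x \<noteq> y"
  shows "ipar (p @ x # y # q) \<longleftrightarrow> \<not> ipar (p @ y # x # q)"
  using assms by (induction p) auto

lemma ipar_rot3:
  assumes "x \<noteq> y" "y \<noteq> z" "x \<noteq> z"
  shows "ipar (p @ z # x # y # q) = ipar (p @ x # y # z # q)"
  using ipar_swap[of z x p "y # q"] ipar_swap[of z y "p @ [x]" q] assms by auto

lemma ipar_snoc: "ipar (u @ [t]) = (ipar u = even (length (filter (\<lambda>x. t < x) u)))"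
  by (induction u) auto

lemma length_filter_less_greater:
  fixes x :: nat
  assumes "x \<notin> set xs"
  shows "length (filter (\<lambda>y. y < x) xs) + length (filter (\<lambda>y. x < y) xs) = length xs"
  using assms by (induction xs) auto

text \<open>The letter \<open>x\<close> passes an even number of letters: those below it and those
  above it are equally many modulo 2.\<close>

lemma ipar_rotate1:
  assumes "x \<notin> set xs" "even (length xs)"
  shows "ipar (xs @ [x]) = ipar (x # xs)"
proof -
  have "even (length (filter (\<lambda>y. y < x) xs)) = even (length (filter (\<lambda>y. x < y) xs))"
    using even_add[of "length (filter (\<lambda>y. y < x) xs)" "length (filter (\<lambda>y. x < y) xs)"]
      assms(2) unfolding length_filter_less_greater[OF assms(1)] by simp
  then show ?thesis by (auto simp: ipar_snoc)
qed

text \<open>Reversal exchanges inversions and non-inversions, so the parity changes by that of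
  \<open>k(k-1)/2\<close>. Only the independence of the word matters later.\<close>

lemma ipar_rev: "\<exists>c. \<forall>u. distinct u \<longrightarrow> length u = k \<longrightarrow> ipar (rev u) = (ipar u = c)"
proof (induction k)
  case 0
  have "\<forall>u. distinct u \<longrightarrow> length u = 0 \<longrightarrow> ipar (rev u) = (ipar u = True)" by simp
  then show ?case by (rule exI)
next
  case (Suc k)
  then obtain c where c: "\<forall>u. distinct u \<longrightarrow> length u = k \<longrightarrow> ipar (rev u) = (ipar u = c)"
    by (elim exE)
  have "ipar (rev u) = (ipar u = (c = even k))" if u: "distinct u" "length u = Suc k" for u
  proof -
    obtain x xs where x: "u = x # xs" using u(2) by (cases u) auto
    with u have x': "distinct xs" "x \<notin> set xs" "length xs = k" by auto
    define A where "A = length (filter (\<lambda>y. y < x) xs)"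
    define B where "B = length (filter (\<lambda>y. x < y) xs)"
    have "A + B = k" unfolding A_def B_def length_filter_less_greater[OF x'(2)] by (rule x')
    then have 1: "even k = (even A = even B)" using even_add[of A B] by simp
    have "length (filter (\<lambda>y. x < y) (rev xs)) = B"
      unfolding B_def by (simp flip: rev_filter)
    then have 2: "ipar (rev u) = (ipar (rev xs) = even B)"
      by (simp add: x ipar_snoc)
    have 3: "ipar u = (even A = ipar xs)" by (simp add: x A_def)
    have 4: "ipar (rev xs) = (ipar xs = c)" using c x' by blast
    show ?thesis unfolding 1 2 3 4 by argo
  qed
  then show ?case by blast
qed

definition words :: "nat set \<Rightarrow> bool \<Rightarrow> nat list set" where
  "words L b = {u. distinct u \<and> set u = L \<and> ipar u = b}"

lemma set_words: "u \<in> words L b \<Longrightarrow> set u = L"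
  by (auto simp: words_def)

lemma length_words: "u \<in> words L b \<Longrightarrow> length u = card L"
  by (auto simp: words_def distinct_card)

lemma finite_words: "finite (words L b)"
proof (cases "finite L")
  case True
  have "words L b \<subseteq> {u. set u \<subseteq> L \<and> distinct u}" by (auto simp: words_def)
  then show ?thesis using finite_subset_distinct[OF True] finite_subset by blast
next
  case False
  then have "words L b = {}" by (auto simp: words_def)
  then show ?thesis by simp
qed

lemma words_swap:
  "p @ x # y # q \<in> words L b \<longleftrightarrow> x \<noteq> y \<and> p @ y # x # q \<in> words L (\<not> b)"
  using ipar_swap[of x y p q] by (auto simp: words_def)

lemma words_rot:
  "p @ z # x # y # q \<in> words L b \<longleftrightarrow> p @ x # y # z # q \<in> words L b"
  using ipar_rot3[of x y z p q] by (auto simp: words_def)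

lemma words_rot':
  "p @ y # z # x # q \<in> words L b \<longleftrightarrow> p @ x # y # z # q \<in> words L b"
  using words_rot[of p y z x q L b] words_rot[of p z x y q L b] by (rule trans)

lemma words_swap2:
  assumes "p @ c # d # x # y # q \<in> words L b"
  shows "p @ d # c # y # x # q \<in> words L b"
  using assms words_swap[of p c d "x # y # q" L b] words_swap[of "p @ [d,c]" x y q L "\<not> b"] by auto

text \<open>A final \<open>t\<close> contributes one inversion for each greater letter of
  \<open>L\<close>, whatever the order of the others. So the words of a class that end in
  \<open>t\<close> form a block that is itself a class on one letter less, which permits induction
  over the alphabet.\<close>

lemma words_snoc:
  assumes t: "t \<in> L"
  shows "\<exists>b'. \<forall>u. u @ [t] \<in> words L b \<longleftrightarrow> u \<in> words (L - {t}) b'"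
proof (intro exI allI)
  fix u
  define c where "c = even (card {x \<in> L - {t}. t < x})"
  have "even (length (filter (\<lambda>x. t < x) u)) = c" if "distinct u" "set u = L - {t}"
  proof -
    have "{x. t < x} \<inter> set u = {x \<in> L - {t}. t < x}" unfolding that(2) by blast
    then show ?thesis unfolding distinct_length_filter[OF that(1)] c_def by simp
  qed
  then have "ipar (u @ [t]) = b \<longleftrightarrow> ipar u = (b = c)" if "distinct u" "set u = L - {t}"
    unfolding ipar_snoc using that by blast
  moreover have "distinct (u @ [t]) \<and> set (u @ [t]) = L \<longleftrightarrow> distinct u \<and> set u = L - {t}"
    using t by auto
  ultimately show "u @ [t] \<in> words L b \<longleftrightarrow>
     u \<in> words (L - {t}) (b = even (card {x \<in> L - {t}. t < x}))"
    unfolding words_def c_def by blast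
qed

lemma words_rev: "\<exists>b'. \<forall>u. rev u \<in> words L b \<longleftrightarrow> u \<in> words L b'"
proof -
  obtain c where c: "\<forall>u. distinct u \<longrightarrow> length u = card L \<longrightarrow> ipar (rev u) = (ipar u = c)"
    using ipar_rev[of "card L"] by (elim exE)
  show ?thesis
    by (rule exI[of _ "b = c"]) (use c in \<open>auto simp: words_def distinct_card\<close>)
qed

text \<open>An exchange of two letters flips the parity, so a prescribed arrangement can be realised
  in either class as long as the order of two adjacent letters is free.\<close>

lemma words_exists:
  assumes "distinct (s @ c # d # r)" "set (s @ c # d # r) = L"
  shows "s @ [c, d] @ r \<in> words L b \<or> s @ [d, c] @ r \<in> words L b"
  using assms ipar_swap[of c d s r] by (auto simp: words_def)

section \<open>Growth by rotations of three consecutive letters\<close>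

definition tri :: "'a list \<Rightarrow> 'a list \<Rightarrow> 'a \<Rightarrow> 'a \<Rightarrow> 'a \<Rightarrow> 'a list set" where
  "tri p q x y z = {p @ [x, y, z] @ q, p @ [z, x, y] @ q, p @ [y, z, x] @ q}"

text \<open>
  The two added words must both be new: a step then merges three different cycles, whereas a rotation
  that meets the same cycle twice could split it.
\<close>

inductive grow1 :: "'a list set \<Rightarrow> 'a list set \<Rightarrow> bool" where
  grow1: "\<lbrakk>p @ [x, y, z] @ q \<in> D; p @ [z, x, y] @ q \<notin> D; p @ [y, z, x] @ q \<notin> D\<rbrakk>
    \<Longrightarrow> grow1 D (D \<union> tri p q x y z)"

abbreviation grow :: "'a list set \<Rightarrow> 'a list set \<Rightarrow> bool" where
  "grow \<equiv> grow1\<^sup>*\<^sup>*"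

lemma grow_step:
  assumes "p @ [x, y, z] @ q \<in> D" "p @ [z, x, y] @ q \<notin> D" "p @ [y, z, x] @ q \<notin> D"
    "D' = D \<union> {p @ [z, x, y] @ q, p @ [y, z, x] @ q}"
  shows "grow D D'"
proof -
  have "D' = D \<union> tri p q x y z" using assms by (auto simp: tri_def)
  then show ?thesis using grow1.intros[OF assms(1-3)] by auto
qed

lemma grow_mono: "grow D D' \<Longrightarrow> D \<subseteq> D'"
  by (induction rule: rtranclp_induct) (auto elim!: grow1.cases)

lemma grow_words: "grow D D' \<Longrightarrow> D \<subseteq> words L b \<Longrightarrow> D' \<subseteq> words L b"
proof (induction rule: rtranclp_induct)
  case (step D1 D2)
  from step(2) show ?case
  proof cases
    case (grow1 p x y z q)
    with step have "p @ x # y # z # q \<in> words L b" by auto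
    with grow1 step show ?thesis
      using words_rot[of p z x y q L b] words_rot'[of p y z x q L b] by (auto simp: tri_def)
  qed
qed

text \<open>Steps inside the block of the words \<open>p @ u @ q\<close> remain steps in the
  presence of further words \<open>E\<close>; disjointness keeps the added words new.\<close>

lemma grow_append:
  assumes "grow D D'" "(\<lambda>u. p @ u @ q) ` D' \<inter> E = {}"
  shows "grow ((\<lambda>u. p @ u @ q) ` D \<union> E) ((\<lambda>u. p @ u @ q) ` D' \<union> E)"
  using assms
proof (induction rule: rtranclp_induct)
  case (step D1 D2)
  from step(2) show ?case
  proof cases
    case (grow1 p' x y z q')
    let ?e = "\<lambda>u. p @ u @ q"
    have "grow (?e ` D1 \<union> E) (?e ` D2 \<union> E)"
    proof (rule grow_step[of "p @ p'" x y z "q' @ q"])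
      show "(p @ p') @ [x, y, z] @ q' @ q \<in> ?e ` D1 \<union> E" using grow1 by force
      have "?e (p' @ [z, x, y] @ q') \<in> ?e ` D2" "?e (p' @ [y, z, x] @ q') \<in> ?e ` D2"
        using grow1 by (auto simp: tri_def)
      then have "?e (p' @ [z, x, y] @ q') \<notin> E" "?e (p' @ [y, z, x] @ q') \<notin> E"
        using step.prems by blast+
      then show "(p @ p') @ [z, x, y] @ q' @ q \<notin> ?e ` D1 \<union> E"
        "(p @ p') @ [y, z, x] @ q' @ q \<notin> ?e ` D1 \<union> E" using grow1 by auto
      show "?e ` D2 \<union> E = ?e ` D1 \<union> E \<union>
         {(p @ p') @ [z, x, y] @ q' @ q, (p @ p') @ [y, z, x] @ q' @ q}"
        using grow1 by (auto simp: tri_def)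
    qed
    moreover have "?e ` D1 \<inter> E = {}" using step.prems grow1 by blast
    ultimately show ?thesis using step.IH by (meson rtranclp_trans)
  qed
qed auto

lemma grow_rev: "grow D D' \<Longrightarrow> grow (rev ` D) (rev ` D')"
proof (induction rule: rtranclp_induct)
  case (step D1 D2)
  from step(2) show ?case
  proof cases
    case (grow1 p x y z q)
    have "grow (rev ` D1) (rev ` D2)"
    proof (rule grow_step[of "rev q" z y x "rev p"])
      show "rev q @ [z, y, x] @ rev p \<in> rev ` D1" 
        using grow1 by (intro image_eqI[of _ _ "p @ [x, y, z] @ q"]) auto
      have "w \<in> rev ` D1 \<longleftrightarrow> rev w \<in> D1" for w by (metis image_iff rev_rev_ident)
      then show "rev q @ [x, z, y] @ rev p \<notin> rev ` D1" "rev q @ [y, x, z] @ rev p \<notin> rev ` D1"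
        using grow1 by auto
      show "rev ` D2 = rev ` D1 \<union> {rev q @ [x, z, y] @ rev p, rev q @ [y, x, z] @ rev p}"
      proof -
        have "D2 = D1 \<union> {p @ [z, x, y] @ q, p @ [y, z, x] @ q}"
          using grow1 by (auto simp: tri_def)
        then show ?thesis by (simp add: insert_commute)
      qed
    qed
    then show ?thesis using step.IH by (meson rtranclp_trans)
  qed
qed auto

section \<open>Growth from two words\<close>

declare ipar.simps [simp del]

lemma grow_block:
  assumes "grow {u. u @ q \<in> D} W"
  shows "grow D (D \<union> (\<lambda>u. u @ q) ` W)"
proof -
  let ?D = "{u. u @ q \<in> D}"
  define E where "E = D - (\<lambda>u. u @ q) ` ?D"
  have "(\<lambda>u. [] @ u @ q) ` W \<inter> E = {}" by (auto simp: E_def)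
  then have "grow ((\<lambda>u. u @ q) ` ?D \<union> E) ((\<lambda>u. u @ q) ` W \<union> E)"
    using grow_append[OF assms, of "[]" q E] by simp
  moreover have "(\<lambda>u. u @ q) ` ?D \<union> E = D" by (auto simp: E_def)
  moreover have "(\<lambda>u. u @ q) ` W \<union> E = D \<union> (\<lambda>u. u @ q) ` W"
    using grow_mono[OF assms] by (auto simp: E_def)
  ultimately show ?thesis by simp
qed

text \<open>A triple is symmetric under rotation, so it does not matter which of its words is the
  one already present.\<close>

lemma grow_tri:
  assumes "D \<inter> tri p q x y z = {w}" "distinct [x, y, z]"
  shows "grow D (D \<union> tri p q x y z)"
proof -
  have mem: "v \<in> D \<longleftrightarrow> v = w" if "v \<in> tri p q x y z" for v using assms(1) that by blast
  have in_tri: "p @ [x, y, z] @ q \<in> tri p q x y z" "p @ [z, x, y] @ q \<in> tri p q x y z"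
    "p @ [y, z, x] @ q \<in> tri p q x y z" by (simp_all add: tri_def)
  note m = in_tri[THEN mem]
  have tri: "tri p q x y z = {p @ [x, y, z] @ q, p @ [z, x, y] @ q, p @ [y, z, x] @ q}"
    by (rule tri_def)
  have "w \<in> tri p q x y z" using assms(1) by blast
  then consider "w = p @ [x, y, z] @ q" | "w = p @ [z, x, y] @ q" | "w = p @ [y, z, x] @ q"
    unfolding tri by blast
  then show ?thesis
  proof cases
    case 1
    show ?thesis
      by (rule grow_step[of p x y z q]) (use 1 m assms(2) in \<open>simp_all add: tri insert_absorb\<close>)
  next
    case 2
    show ?thesis
      by (rule grow_step[of p z x y q]) (use 2 m assms(2) in \<open>simp_all add: tri insert_absorb insert_commute\<close>)
  next
    case 3
    show ?thesis
      by (rule grow_step[of p y z x q]) (use 3 m assms(2) in \<open>simp_all add: tri insert_absorb insert_commute\<close>)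
  qed
qed

section \<open>Filling a class from two close words\<close>

text \<open>Four is the window length because on four letters any two distinct words of a class
  suffice (\<open>growable4\<close>). In a longer word some letter at one of the ends lies outside
  the window and can be split off.\<close>

definition close :: "'a list \<Rightarrow> 'a list \<Rightarrow> bool" where
  "close u u' \<longleftrightarrow> u \<noteq> u' \<and>
     (\<exists>p v v' q. u = p @ v @ q \<and> u' = p @ v' @ q \<and> length v = 4 \<and> length v' = 4)"

lemma closeI: "u = p @ v @ q \<Longrightarrow> u' = p @ v' @ q \<Longrightarrow> length v = 4 \<Longrightarrow> length v' = 4 \<Longrightarrow> u \<noteq> u' \<Longrightarrow> close u u'"
  unfolding close_def by blast

lemma close_rot:
  assumes "u = p @ [x, y, z] @ q" "u' = p @ [z, x, y] @ q" "distinct [x, y, z]" "length u \<ge> 4"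
  shows "close u u'"
proof (cases q)
  case Nil
  with assms obtain p' e where "p = p' @ [e]" by (cases p rule: rev_cases) auto
  with Nil assms show ?thesis by (intro closeI[of _ p' "[e, x, y, z]" "[]" _ "[e, z, x, y]"]) auto
next
  case (Cons e q')
  with assms show ?thesis by (intro closeI[of _ p "[x, y, z, e]" q' _ "[z, x, y, e]"]) auto
qed

lemma close_sym: "close u v \<Longrightarrow> close v u"
  unfolding close_def by blast

text \<open>
  Steps preserve the parity of the number of words, and classes of words on at least four letters have
  even size, so growth cannot start from a single word.
\<close>

definition growable :: "nat \<Rightarrow> bool" where
  "growable k \<longleftrightarrow> (\<forall>L b u v. finite L \<longrightarrow> card L = k \<longrightarrow> u \<in> words L b \<longrightarrow> v \<in> words L b \<longrightarrow>
     close u v \<longrightarrow> grow {u, v} (words L b))"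

definition ending :: "nat set \<Rightarrow> bool \<Rightarrow> nat set \<Rightarrow> nat list set" where
  "ending L b F = {u \<in> words L b. u \<noteq> [] \<and> last u \<in> F}"

lemma ending_Un: "ending L b (F \<union> G) = ending L b F \<union> ending L b G"
  by (auto simp: ending_def)

lemma ending_all: "L \<noteq> {} \<Longrightarrow> ending L b L = words L b"
proof -
  assume L: "L \<noteq> {}"
  have "u \<noteq> [] \<and> last u \<in> L" if "u \<in> words L b" for u
    using last_in_set[of u] set_words[OF that] L by auto
  then show ?thesis by (auto simp: ending_def)
qed

lemma ending_snoc: "u @ [t] \<in> ending L b F \<longleftrightarrow> u @ [t] \<in> words L b \<and> t \<in> F"
  by (auto simp: ending_def)

lemma ending_single:
  assumes "\<And>u. u @ [t] \<in> words L b \<longleftrightarrow> u \<in> words (L - {t}) b'"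
  shows "(\<lambda>u. u @ [t]) ` words (L - {t}) b' = ending L b {t}"
proof (intro equalityI subsetI)
  fix w assume "w \<in> ending L b {t}"
  then have w: "w = butlast w @ [t]" "w \<in> words L b" by (auto simp: ending_def)
  then have "butlast w \<in> words (L - {t}) b'" using assms[of "butlast w"] by simp
  with w(1) show "w \<in> (\<lambda>u. u @ [t]) ` words (L - {t}) b'" by (rule image_eqI)
qed (use assms in \<open>auto simp: ending_def\<close>)

lemma words3:
  assumes "[x, y, z] \<in> words L b"
  shows "words L b = tri [] [] x y z"
proof -
  have d: "x \<noteq> y" "y \<noteq> z" "x \<noteq> z" "L = {x, y, z}" "ipar [x, y, z] = b"
    using assms by (auto simp: words_def)
  have p: "ipar [z, x, y] = b" "ipar [y, z, x] = b" "ipar [y, x, z] \<noteq> b" "ipar [x, z, y] \<noteq> b"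
    "ipar [z, y, x] \<noteq> b"
    using d ipar_rot3[of x y z "[]" "[]"] ipar_rot3[of z x y "[]" "[]"] ipar_swap[of x y "[]" "[z]"]
      ipar_swap[of y z "[x]" "[]"] ipar_swap[of x y "[z]" "[]"] by auto
  show ?thesis
  proof (intro equalityI subsetI)
    fix w assume w: "w \<in> words L b"
    then have "length w = 3" using d by (auto dest: length_words)
    then obtain i j k where "w = [i, j, k]" by (auto simp: numeral_3_eq_3 length_Suc_conv)
    with w have ijk: "i \<in> {x, y, z}" "j \<in> {x, y, z}" "k \<in> {x, y, z}" "distinct [i, j, k]"
      "ipar [i, j, k] = b" "w = [i, j, k]"
      using d(4) by (auto simp: words_def)
    then show "w \<in> tri [] [] x y z" using p by (auto simp: tri_def)
  next
    fix w assume "w \<in> tri [] [] x y z"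
    then have "distinct w \<and> set w = {x, y, z} \<and> ipar w = b"
      unfolding tri_def using d(1-3,5) p by (elim insertE) auto
    then show "w \<in> words L b" by (simp add: words_def d(4))
  qed
qed

lemma ending_tri:
  assumes "[x, y, z, t] \<in> words L b"
  shows "ending L b {t} = tri [] [t] x y z"
proof -
  have t: "t \<in> L" "finite L" using assms by (auto simp: words_def)
  obtain b' where b': "\<And>u. u @ [t] \<in> words L b \<longleftrightarrow> u \<in> words (L - {t}) b'"
    using words_snoc[OF t(1)] by blast
  have "[x, y, z] \<in> words (L - {t}) b'" using assms b'[of "[x, y, z]"] by simp
  from words3[OF this] show ?thesis using ending_single[OF b'] by (auto simp: tri_def)
qed

text \<open>On four letters each block with fixed last letter is a single rotation triple by
  \<open>ending_tri\<close>, so it is enough to find one word in each block by even moves.\<close>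

lemma words4:
  assumes "[b, c, d, a] \<in> words L s"
  shows "words L s = tri [] [a] b c d \<union> tri [] [b] a d c \<union> tri [] [c] a b d \<union> tri [] [d] a c b"
proof -
  have L: "L = {a} \<union> {b} \<union> {c} \<union> {d}" using assms by (auto simp: words_def)
  have 1: "[c, b, a, d] \<in> words L s" using words_swap2[of "[]" b c d a "[]" L s] assms by simp
  then have 2: "[c, a, d, b] \<in> words L s" using words_rot'[of "[c]" a d b "[]"] by simp
  have 3: "[b, d, a, c] \<in> words L s" using assms words_rot'[of "[b]" d a c "[]"] by simp
  have "words L s = ending L s L" using L by (simp add: ending_all)
  also have "\<dots> = ending L s {a} \<union> ending L s {b} \<union> ending L s {c} \<union> ending L s {d}"
    unfolding ending_Un[symmetric] L by simp
  finally show ?thesis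
    unfolding ending_tri[OF assms] ending_tri[OF 1] ending_tri[OF 2] ending_tri[OF 3]
    by (auto simp: tri_def)
qed

text \<open>Fill the blocks of the two last letters \<open>a\<close> and \<open>b\<close>. The
  triple \<open>?F\<close> behind an initial \<open>a\<close> meets them only in
  \<open>[a, d, c, b]\<close>, and its other two words open the blocks of \<open>c\<close> and
  \<open>d\<close>.\<close>

lemma grow4_last:
  assumes "u \<in> words L s" "v \<in> words L s" "card L = 4" "last u \<noteq> last v"
  shows "grow {u, v} (words L s)"
proof -
  have "length u = 4" "length v = 4" using assms by (auto dest: length_words)
  then obtain x y z a where u: "u = [x, y, z, a]"
    by (auto simp: numeral_eq_Suc length_Suc_conv)
  have "v \<noteq> []" using \<open>length v = 4\<close> by auto
  define b where "b = last v"
  have "b \<in> L" using assms(2) \<open>v \<noteq> []\<close> by (auto simp: b_def words_def)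
  moreover have "b \<noteq> a" using assms(4) by (auto simp: b_def u)
  ultimately have "b \<in> {x, y, z}" using assms(1) by (auto simp: u words_def)
  then consider "b = x" | "b = y" | "b = z" by blast
  then obtain c d where u_cases: "u = [b, c, d, a] \<or> u = [d, b, c, a] \<or> u = [c, d, b, a]"
    unfolding u by cases blast+
  then have ucd: "u \<in> tri [] [a] b c d" by (auto simp: tri_def)
  have w: "[b, c, d, a] \<in> words L s"
    using u_cases assms(1) words_rot[of "[]" d b c "[a]" L s] words_rot'[of "[]" c d b "[a]" L s]
    by (elim disjE) simp_all
  note W = words4[OF w]
  have dist: "distinct [a, b, c, d]" using w by (auto simp: words_def)
  have "v \<in> ending L s {b}" using assms(2) \<open>v \<noteq> []\<close> by (auto simp: ending_def b_def)
  moreover have "ending L s {b} = tri [] [b] a d c"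
    by (rule ending_tri) (simp add: W tri_def)
  ultimately have v: "v \<in> tri [] [b] a d c" by simp
  let ?A = "tri [] [a] b c d" and ?B = "tri [] [b] a d c" and ?C = "tri [] [c] a b d"
    and ?D = "tri [] [d] a c b" and ?F = "tri [a] [] d c b"
  have ne: "a \<noteq> b" "a \<noteq> c" "a \<noteq> d" "b \<noteq> a" "b \<noteq> c" "b \<noteq> d" "c \<noteq> a" "c \<noteq> b" "c \<noteq> d"
    "d \<noteq> a" "d \<noteq> b" "d \<noteq> c" using dist by auto
  have AB: "?A \<inter> ?B = {}" by (simp add: tri_def ne)
  have g1: "grow {u, v} ({u, v} \<union> ?A)"
    by (rule grow_tri[of _ _ _ _ _ _ u]) (use ucd v AB in blast, simp add: ne)
  have g2: "grow ({v} \<union> ?A) ({v} \<union> ?A \<union> ?B)"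
    by (rule grow_tri[of _ _ _ _ _ _ v]) (use v AB in blast, simp add: ne)
  have g3: "grow (?A \<union> ?B) (?A \<union> ?B \<union> ?F)"
    by (rule grow_tri[of _ _ _ _ _ _ "[a, d, c, b]"]) (simp_all add: tri_def ne)
  have g4: "grow (?A \<union> ?B \<union> ?F) (?A \<union> ?B \<union> ?F \<union> ?C)"
    by (rule grow_tri[of _ _ _ _ _ _ "[a, b, d, c]"]) (simp_all add: tri_def ne)
  have g5: "grow (?A \<union> ?B \<union> ?F \<union> ?C) (?A \<union> ?B \<union> ?F \<union> ?C \<union> ?D)"
    by (rule grow_tri[of _ _ _ _ _ _ "[a, c, b, d]"]) (simp_all add: tri_def ne)
  have e1: "{u, v} \<union> ?A = {v} \<union> ?A" using ucd by auto
  have e2: "{v} \<union> ?A \<union> ?B = ?A \<union> ?B" using v by auto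
  have e3: "?A \<union> ?B \<union> ?F \<union> ?C \<union> ?D = words L s" unfolding W by (auto simp: tri_def)
  show ?thesis
    using rtranclp_trans[OF g1[unfolded e1] rtranclp_trans[OF g2[unfolded e2]
        rtranclp_trans[OF g3 rtranclp_trans[OF g4 g5[unfolded e3]]]]] .
qed

text \<open>By this symmetry an argument about last letters also serves for first letters. The
  reversed words may lie in the other class, hence the third assumption for every
  \<open>b\<close>.\<close>

lemma grow_words_rev:
  assumes "u \<in> words L b" "v \<in> words L b"
    "\<And>b. rev u \<in> words L b \<Longrightarrow> rev v \<in> words L b \<Longrightarrow> grow {rev u, rev v} (words L b)"
  shows "grow {u, v} (words L b)"
proof -
  obtain b' where b': "\<And>u. rev u \<in> words L b \<longleftrightarrow> u \<in> words L b'"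
    using words_rev by blast
  have "grow {rev u, rev v} (words L b')"
    using assms b'[of "rev u"] b'[of "rev v"] by simp
  from grow_rev[OF this] have "grow {u, v} (rev ` words L b')" by simp
  moreover have "rev ` words L b' = words L b"
  proof (intro equalityI subsetI)
    fix w assume "w \<in> words L b"
    then have "rev w \<in> words L b'" using b'[of "rev w"] by simp
    then show "w \<in> rev ` words L b'" by (intro image_eqI[of _ _ "rev w"]) simp_all
  qed (use b' in auto)
  ultimately show ?thesis by simp
qed

lemma growable4: "growable 4"
  unfolding growable_def
proof (intro allI impI)
  fix L :: "nat set" and s u v
  assume *: "finite L" "card L = 4" "u \<in> words L s" "v \<in> words L s" "close u v"
  then have uv: "u \<noteq> v" by (auto simp: close_def)
  show "grow {u, v} (words L s)"
  proof (cases "last u = last v")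
    case False
    then show ?thesis using grow4_last * by blast
  next
    case True
    have "length u = 4" "length v = 4" using * by (auto dest: length_words)
    then obtain x y z a x' y' z' where u: "u = [x, y, z, a]" and v: "v = [x', y', z', a]"
      using True by (auto simp: numeral_eq_Suc length_Suc_conv)
    \<comment> \<open>If the first letters agreed as well, the words would differ by exchanging the
      two middle letters, against parity. So the reversed words have different last letters.\<close>
    have "x \<noteq> x'"
      using * uv words_swap[of "[x]" y z "[a]" L s] unfolding u v by (auto simp: words_def)
    show ?thesis
    proof (rule grow_words_rev[OF *(3,4)])
      show "grow {rev u, rev v} (words L b)" if "rev u \<in> words L b" "rev v \<in> words L b" for b
        using grow4_last[OF that *(2)] \<open>x \<noteq> x'\<close> by (simp add: u v)
    qed
  qed
qed

lemma grow_ending: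
  assumes k: "growable k" and L: "finite L" "card L = Suc k" "t \<in> L"
    and D: "{u. u @ [t] \<in> D} = {u, v}" "D \<subseteq> words L b" and "close u v"
  shows "grow D (D \<union> ending L b {t})"
proof -
  obtain b' where b': "\<And>u. u @ [t] \<in> words L b \<longleftrightarrow> u \<in> words (L - {t}) b'"
    using words_snoc[OF L(3)] by blast
  have "grow {u. u @ [t] \<in> D} (words (L - {t}) b')"
    unfolding D using k[unfolded growable_def, rule_format, of "L - {t}" u b' v] L D b' \<open>close u v\<close>
    by auto
  from grow_block[OF this] show ?thesis unfolding ending_single[OF b'] .
qed

text \<open>The two given words open the blocks of \<open>x\<close> and \<open>y\<close>. A second
  rotation, at \<open>p' @ [y, x, z]\<close>, adds to each block a word close to the first; the
  exchange of \<open>c\<close> and \<open>d\<close> in \<open>p'\<close> compensates that of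
  \<open>x\<close> and \<open>y\<close>. The given words are kept apart from the step that produces
  them because in \<open>grow_seed\<close> they belong to the seed already.\<close>

lemma grow_half_pair:
  assumes k: "growable k" and L: "finite L" "card L = Suc k" "F \<subseteq> L"
    and xyz: "x \<in> L - F" "y \<in> L - F" "z \<in> F" and p: "p = w @ [c, d]"
    and in_words: "p @ [x, y, z] \<in> words L b"
  shows "grow (ending L b F \<union> {p @ [z, x, y], p @ [y, z, x]}) (ending L b (F \<union> {x, y}))"
proof -
  define p' where "p' = w @ [d, c]"
  have dist: "distinct [x, y, z, c, d]" using in_words by (auto simp: words_def p)
  have p'_words: "p' @ [y, x, z] \<in> words L b"
    using words_swap2[of w c d x y "[z]"] in_words by (simp add: p p'_def)
  have all_words: "p @ [z, x, y] \<in> words L b" "p @ [y, z, x] \<in> words L b"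
    "p' @ [z, y, x] \<in> words L b" "p' @ [x, z, y] \<in> words L b"
    using in_words p'_words words_rot[of p z x y "[]"] words_rot'[of p y z x "[]"]
      words_rot[of p' z y x "[]"] words_rot'[of p' x z y "[]"] by auto
  define D1 where "D1 = ending L b F \<union> {p @ [z, x, y], p @ [y, z, x]}"
  define D2 where "D2 = D1 \<union> {p' @ [z, y, x], p' @ [x, z, y]}"
  have g1: "grow D1 D2"
  proof (rule grow_step[of p' y x z "[]"])
    show "p' @ [y, x, z] @ [] \<in> D1" using p'_words xyz by (simp add: D1_def ending_def)
    show "p' @ [z, y, x] @ [] \<notin> D1" "p' @ [x, z, y] @ [] \<notin> D1"
      using xyz dist by (auto simp: D1_def ending_def p p'_def)
  qed (simp add: D2_def)
  have D2_words: "D2 \<subseteq> words L b" using all_words by (auto simp: D1_def D2_def ending_def)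
  have g2: "grow D2 (D2 \<union> ending L b {x})"
  proof (rule grow_ending[OF k L(1,2)])
    show "{u. u @ [x] \<in> D2} = {w @ [c, d, y, z], w @ [d, c, z, y]}"
      using xyz dist by (auto simp: D1_def D2_def ending_snoc p p'_def)
    show "close (w @ [c, d, y, z]) (w @ [d, c, z, y])"
      using dist by (intro closeI[of _ w "[c, d, y, z]" "[]" _ "[d, c, z, y]"]) auto
  qed (use xyz D2_words in auto)
  have g3: "grow (D2 \<union> ending L b {x}) (D2 \<union> ending L b {x} \<union> ending L b {y})"
  proof (rule grow_ending[OF k L(1,2)])
    show "{u. u @ [y] \<in> D2 \<union> ending L b {x}} = {w @ [c, d, z, x], w @ [d, c, x, z]}"
      using xyz dist by (auto simp: D1_def D2_def ending_snoc p p'_def)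
    show "close (w @ [c, d, z, x]) (w @ [d, c, x, z])"
      using dist by (intro closeI[of _ w "[c, d, z, x]" "[]" _ "[d, c, x, z]"]) auto
  qed (use xyz D2_words in \<open>auto simp: ending_def\<close>)
  have "D2 \<union> ending L b {x} \<union> ending L b {y} = ending L b (F \<union> {x, y})"
    using all_words by (auto simp: D1_def D2_def ending_def)
  with rtranclp_trans[OF g1 rtranclp_trans[OF g2 g3]] show ?thesis unfolding D1_def by simp
qed

text \<open>As \<open>k \<ge> 4\<close>, two letters besides \<open>x\<close>, \<open>y\<close>,
  \<open>z\<close> are available for \<open>grow_half_pair\<close>; their order is chosen to fit the
  parity.\<close>

lemma grow_pair:
  assumes k: "growable k" "k \<ge> 4" and L: "finite L" "card L = Suc k" "F \<subseteq> L"
    and xyz: "x \<in> L - F" "y \<in> L - F" "x \<noteq> y" "z \<in> F"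
  shows "grow (ending L b F) (ending L b (F \<union> {x, y}))"
proof -
  have dist: "distinct [x, y, z]" using xyz by auto
  have "card (L - {x, y, z}) = k - 2"
    using L xyz dist by (subst card_Diff_subset) auto
  moreover obtain r where r: "set r = L - {x, y, z}" "distinct r"
    using finite_distinct_list[of "L - {x, y, z}"] L by auto
  ultimately have "length r \<ge> 2" using k distinct_card[OF r(2)] r(1) by simp
  then obtain c' d' w where cd': "r = c' # d' # w"
    by (auto simp: numeral_2_eq_2 Suc_le_length_iff)
  have "w @ [c', d'] @ [x, y, z] \<in> words L b \<or> w @ [d', c'] @ [x, y, z] \<in> words L b"
    by (rule words_exists) (use r cd' dist xyz L in auto)
  then obtain c d where cd: "(w @ [c, d]) @ [x, y, z] \<in> words L b" by auto
  define p where "p = w @ [c, d]"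
  have "grow (ending L b F) (ending L b F \<union> {p @ [z, x, y], p @ [y, z, x]})"
    by (rule grow_step[of p x y z "[]"])
       (use cd xyz in \<open>auto simp: p_def ending_def\<close>)
  also have "grow \<dots> (ending L b (F \<union> {x, y}))"
    by (rule grow_half_pair[OF k(1) L xyz(1,2,4) p_def]) (use cd in \<open>simp add: p_def\<close>)
  finally show ?thesis .
qed

text \<open>
  Words with a new last letter always come in two blocks at a time, so an odd number of blocks needs
  this step for three blocks at once.
\<close>

lemma grow_triangle_aux:
  assumes k: "growable k" "k \<ge> 4" and L: "finite L" "card L = Suc k" "F \<subseteq> L"
    and xyz: "x \<in> L - F" "y \<in> L - F" "c \<in> L - F" "z \<in> F"
    and in_words: "w @ [x, y, c, z] \<in> words L b"
  shows "grow (ending L b F) (ending L b (F \<union> {x, y, c}))"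
proof -
  have dist: "distinct [x, y, z, c]" using in_words by (auto simp: words_def)
  have base: "w @ [c, x, y, z] \<in> words L b" "w @ [y, c, x, z] \<in> words L b"
    using in_words words_rot[of w c x y "[z]"] words_rot'[of w y c x "[z]"] by auto
  have all_words: "w @ [c, z, x, y] \<in> words L b" "w @ [c, y, z, x] \<in> words L b"
    "w @ [x, z, y, c] \<in> words L b" "w @ [x, c, z, y] \<in> words L b"
    "w @ [y, z, c, x] \<in> words L b" "w @ [y, x, z, c] \<in> words L b"
    using in_words base words_rot[of "w @ [c]" z x y "[]"] words_rot'[of "w @ [c]" y z x "[]"]
      words_rot[of "w @ [x]" z y c "[]"] words_rot'[of "w @ [x]" c z y "[]"]
      words_rot[of "w @ [y]" z c x "[]"] words_rot'[of "w @ [y]" x z c "[]"] by auto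
  define D1 where "D1 = ending L b F \<union> {w @ [c, z, x, y], w @ [c, y, z, x]}"
  define D2 where "D2 = D1 \<union> {w @ [x, z, y, c], w @ [x, c, z, y]}"
  define D3 where "D3 = D2 \<union> {w @ [y, z, c, x], w @ [y, x, z, c]}"
  have len: "length w + 4 = Suc k" using length_words[OF in_words] L by simp
  have g1: "grow (ending L b F) D1"
    by (rule grow_step[of "w @ [c]" x y z "[]"]) (use base xyz in \<open>auto simp: D1_def ending_def\<close>)
  have g2: "grow D1 D2"
    by (rule grow_step[of "w @ [x]" y c z "[]"])
       (use in_words xyz dist in \<open>auto simp: D2_def D1_def ending_def\<close>)
  have g3: "grow D2 D3"
    by (rule grow_step[of "w @ [y]" c x z "[]"])
       (use base xyz dist in \<open>auto simp: D3_def D2_def D1_def ending_def\<close>)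
  have D3_words: "D3 \<subseteq> words L b"
    using all_words by (auto simp: D1_def D2_def D3_def ending_def)
  have g4: "grow D3 (D3 \<union> ending L b {x})"
  proof (rule grow_ending[OF k(1) L(1,2)])
    show "{u. u @ [x] \<in> D3} = {w @ [c, y, z], w @ [y, z, c]}"
      using xyz dist by (auto simp: D1_def D2_def D3_def ending_snoc)
    show "close (w @ [c, y, z]) (w @ [y, z, c])"
      using dist len k by (intro close_sym[OF close_rot[of _ w y z c "[]"]]) auto
  qed (use xyz D3_words in auto)
  have g5: "grow (D3 \<union> ending L b {x}) (D3 \<union> ending L b {x} \<union> ending L b {y})"
  proof (rule grow_ending[OF k(1) L(1,2)])
    show "{u. u @ [y] \<in> D3 \<union> ending L b {x}} = {w @ [c, z, x], w @ [x, c, z]}"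
      using xyz dist by (auto simp: D1_def D2_def D3_def ending_snoc)
    show "close (w @ [c, z, x]) (w @ [x, c, z])"
      using dist len k by (intro close_rot[of _ w c z x "[]"]) auto
  qed (use xyz D3_words in \<open>auto simp: ending_def\<close>)
  have g6: "grow (D3 \<union> ending L b {x} \<union> ending L b {y})
     (D3 \<union> ending L b {x} \<union> ending L b {y} \<union> ending L b {c})"
  proof (rule grow_ending[OF k(1) L(1,2)])
    show "{u. u @ [c] \<in> D3 \<union> ending L b {x} \<union> ending L b {y}} = {w @ [x, z, y], w @ [y, x, z]}"
      using xyz dist by (auto simp: D1_def D2_def D3_def ending_snoc)
    show "close (w @ [x, z, y]) (w @ [y, x, z])"
      using dist len k by (intro close_rot[of _ w x z y "[]"]) auto
  qed (use xyz D3_words in \<open>auto simp: ending_def\<close>)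
  have "D3 \<union> ending L b {x} \<union> ending L b {y} \<union> ending L b {c} = ending L b (F \<union> {x, y, c})"
    using all_words by (auto simp: D1_def D2_def D3_def ending_def)
  with rtranclp_trans[OF g1 rtranclp_trans[OF g2 rtranclp_trans[OF g3
      rtranclp_trans[OF g4 rtranclp_trans[OF g5 g6]]]]]
  show ?thesis by simp
qed

lemma grow_triangle:
  assumes k: "growable k" "k \<ge> 4" and L: "finite L" "card L = Suc k" "F \<subseteq> L"
    and xyz: "x \<in> L - F" "y \<in> L - F" "c \<in> L - F" "z \<in> F" "distinct [x, y, c]"
  shows "grow (ending L b F) (ending L b (F \<union> {x, y, c}))"
proof -
  obtain w where w: "set w = L - {x, y, c, z}" "distinct w"
    using finite_distinct_list[of "L - {x, y, c, z}"] L by auto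
  have "w @ [x, y] @ [c, z] \<in> words L b \<or> w @ [y, x] @ [c, z] \<in> words L b"
    by (rule words_exists) (use w xyz L in auto)
  then have "w @ [x, y, c, z] \<in> words L b \<or> w @ [y, x, c, z] \<in> words L b" by simp
  then show ?thesis
  proof
    assume "w @ [x, y, c, z] \<in> words L b"
    then show ?thesis by (rule grow_triangle_aux[OF k L xyz(1-4)])
  next
    assume "w @ [y, x, c, z] \<in> words L b"
    then have "grow (ending L b F) (ending L b (F \<union> {y, x, c}))"
      by (rule grow_triangle_aux[OF k L xyz(2,1,3,4)])
    then show ?thesis by (simp add: insert_commute)
  qed
qed

text \<open>Every number except 1 is a sum of twos and at most one three. Three missing blocks are a
  case of their own, since a pair would leave a single block over.\<close>

lemma grow_fill:
  assumes k: "growable k" "k \<ge> 4" and L: "finite L" "card L = Suc k" 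
    and F: "F \<subseteq> L" "F \<noteq> {}" "card (L - F) \<noteq> 1"
  shows "grow (ending L b F) (words L b)"
  using F
proof (induction "card (L - F)" arbitrary: F rule: less_induct)
  case less
  obtain z where z: "z \<in> F" using less.prems by auto
  have fin: "finite (L - F)" using L by simp
  consider "card (L - F) = 0" | "card (L - F) = 3" | "card (L - F) \<ge> 2" "card (L - F) \<noteq> 3"
    using less.prems by linarith
  then show ?case
  proof cases
    case 1
    then have "F = L" using fin less.prems by auto
    moreover have "L \<noteq> {}" using L by auto
    ultimately show ?thesis using ending_all by simp
  next
    case 2
    then obtain x y c where xyc: "L - F = {x, y, c}" "distinct [x, y, c]"
      by (auto simp: card_3_iff)
    then have "F \<union> {x, y, c} = L" using less.prems by blast
    moreover have "grow (ending L b F) (ending L b (F \<union> {x, y, c}))"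
      by (rule grow_triangle[OF k L less.prems(1)]) (use xyc z in auto)
    moreover have "L \<noteq> {}" using L by auto
    ultimately show ?thesis using ending_all by simp
  next
    case 3
    obtain G where "G \<subseteq> L - F" "card G = 2"
      using obtain_subset_with_card_n[OF 3(1)] by blast
    then obtain x y where xy: "x \<in> L - F" "y \<in> L - F" "x \<noteq> y"
      by (auto simp: card_2_iff)
    have "L - (F \<union> {x, y}) = (L - F) - {x, y}" by auto
    then have "card (L - (F \<union> {x, y})) = card (L - F) - 2"
      using xy fin by (simp add: card_Diff_subset)
    then have "grow (ending L b (F \<union> {x, y})) (words L b)"
      using less.prems xy 3 by (intro less.hyps) auto
    moreover have "grow (ending L b F) (ending L b (F \<union> {x, y}))"
      by (rule grow_pair[OF k L less.prems(1) xy z])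
    ultimately show ?thesis by (rule rtranclp_trans[rotated])
  qed
qed

text \<open>A letter outside the window can be taken as the common last letter, if necessary after
  reversal. Its block is filled by the induction hypothesis, and this one block is enough for
  \<open>grow_fill\<close>, because \<open>k \<ge> 4\<close> blocks are missing.\<close>

lemma growable: "k \<ge> 4 \<Longrightarrow> growable k"
proof (induction k rule: dec_induct)
  case base
  show ?case by (rule growable4)
next
  case (step k)
  have last: "grow {u, v} (words L b)"
    if L: "finite L" "card L = Suc k" and uv: "u \<in> words L b" "v \<in> words L b"
      "u = p @ r @ q" "v = p @ r' @ q" "length r = 4" "length r' = 4" "u \<noteq> v" "q \<noteq> []"
    for L b u v p r r' q
  proof -
    obtain q' t where q: "q = q' @ [t]" using \<open>q \<noteq> []\<close> by (cases q rule: rev_cases) auto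
    have t: "t \<in> L" using uv q by (auto simp: words_def)
    have "grow {u, v} ({u, v} \<union> ending L b {t})"
    proof (rule grow_ending[OF step.IH L t])
      show "{w. w @ [t] \<in> {u, v}} = {p @ r @ q', p @ r' @ q'}" using uv q by auto
      show "close (p @ r @ q') (p @ r' @ q')" 
        using uv q by (intro closeI[of _ p r q' _ r']) auto
    qed (use uv in auto)
    moreover have "{u, v} \<union> ending L b {t} = ending L b {t}"
      using uv q by (auto simp: ending_def)
    moreover have "grow (ending L b {t}) (words L b)"
      by (rule grow_fill[OF step.IH step.hyps(1) L]) (use t L step.hyps in auto)
    ultimately show ?thesis by (simp add: rtranclp_trans)
  qed
  show ?case
    unfolding growable_def
  proof (intro allI impI)
    fix L :: "nat set" and b u v
    assume *: "finite L" "card L = Suc k" "u \<in> words L b" "v \<in> words L b" "close u v"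
    then obtain p r r' q where pq: "u = p @ r @ q" "v = p @ r' @ q" "length r = 4" "length r' = 4" "u \<noteq> v"
      by (auto simp: close_def)
    show "grow {u, v} (words L b)"
    proof (cases "q = []")
      case False
      then show ?thesis using last * pq by blast
    next
      case True
      then have "p \<noteq> []" using length_words[OF *(3)] pq * step.hyps by auto
      show ?thesis
      proof (rule grow_words_rev[OF *(3,4)])
        show "grow {rev u, rev v} (words L b)" if "rev u \<in> words L b" "rev v \<in> words L b" for b
          by (rule last[OF *(1,2) that, of "rev q" "rev r" "rev p" "rev r'"])
             (use pq \<open>p \<noteq> []\<close> in auto)
      qed
    qed
  qed
qed

section \<open>Growth from the seed\<close>

text \<open>
  The cyclic words that contain the words \<open>w x y z\<close>, \<open>w z x y\<close>, \<open>w y z x\<close>, where \<open>w x\<close> runs through the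
  rotations of \<open>p v\<close>, cut at \<open>p\<close>. The word \<open>y v z\<close> of \<open>seed\<close> arises from \<open>x = p\<close>.
\<close>

definition seed0 :: "'a \<Rightarrow> 'a \<Rightarrow> 'a list \<Rightarrow> 'a list set" where
  "seed0 y z v = {v1 @ [y, z] @ v2 | v1 v2. v = v1 @ v2} \<union> {v1 @ [z, x, y] @ v2 | v1 x v2. v = v1 @ x # v2}"

definition seed :: "'a \<Rightarrow> 'a \<Rightarrow> 'a list \<Rightarrow> 'a list set" where
  "seed y z v = insert (y # v @ [z]) (seed0 y z v)"

text \<open>Recursion over the last letter: the block of \<open>t\<close> is the smaller
  \<open>seed0\<close>, and only one word ends in \<open>y\<close> and one in \<open>z\<close>. The
  extra word of \<open>seed\<close> has no such recursion, since \<open>y # v @ [z]\<close> ends in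
  \<open>z\<close>; this is why \<open>seed0\<close> is separate.\<close>

lemma seed0_snoc:
  "seed0 y z (v @ [t]) = (\<lambda>u. u @ [t]) ` seed0 y z v \<union> {v @ [z, t, y], v @ [t, y, z]}"
proof (intro equalityI subsetI)
  fix u assume "u \<in> seed0 y z (v @ [t])"
  then consider v1 v2 where "u = v1 @ [y, z] @ v2" "v @ [t] = v1 @ v2"
    | v1 x v2 where "u = v1 @ [z, x, y] @ v2" "v @ [t] = v1 @ x # v2"
    unfolding seed0_def by blast
  then show "u \<in> (\<lambda>u. u @ [t]) ` seed0 y z v \<union> {v @ [z, t, y], v @ [t, y, z]}"
  proof cases
    case 1
    show ?thesis
    proof (cases v2 rule: rev_cases)
      case Nil
      then show ?thesis using 1 by auto
    next
      case (snoc v2' t')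
      then have "u = (v1 @ [y, z] @ v2') @ [t]" "v1 @ [y, z] @ v2' \<in> seed0 y z v"
        using 1 unfolding seed0_def by auto
      then show ?thesis by blast
    qed
  next
    case 2
    show ?thesis
    proof (cases v2 rule: rev_cases)
      case Nil
      then show ?thesis using 2 by auto
    next
      case (snoc v2' t')
      then have "v = v1 @ x # v2'" and u: "u = (v1 @ [z, x, y] @ v2') @ [t]" using 2 by auto
      then have "v1 @ [z, x, y] @ v2' \<in> seed0 y z v" unfolding seed0_def by blast
      with u show ?thesis by blast
    qed
  qed
next
  fix u assume "u \<in> (\<lambda>u. u @ [t]) ` seed0 y z v \<union> {v @ [z, t, y], v @ [t, y, z]}"
  then consider w where "u = w @ [t]" "w \<in> seed0 y z v" | "u = v @ [z, t, y]" | "u = v @ [t, y, z]"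
    by blast
  then show "u \<in> seed0 y z (v @ [t])"
  proof cases
    case 1
    from 1(2) consider v1 v2 where "w = v1 @ [y, z] @ v2" "v = v1 @ v2"
      | v1 x v2 where "w = v1 @ [z, x, y] @ v2" "v = v1 @ x # v2"
      unfolding seed0_def by blast
    then show ?thesis
    proof cases
      case (1 v1 v2)
      then have "u = v1 @ [y, z] @ (v2 @ [t])" "v @ [t] = v1 @ (v2 @ [t])" using \<open>u = w @ [t]\<close> by auto
      then show ?thesis unfolding seed0_def by blast
    next
      case (2 v1 x v2)
      then have "u = v1 @ [z, x, y] @ (v2 @ [t])" "v @ [t] = v1 @ x # (v2 @ [t])"
        using \<open>u = w @ [t]\<close> by auto
      then show ?thesis unfolding seed0_def by blast
    qed
  next
    case 2
    then have "u = v @ [z, t, y] @ []" "v @ [t] = v @ t # []" by auto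
    then show ?thesis unfolding seed0_def by blast
  next
    case 3
    then have "u = (v @ [t]) @ [y, z] @ []" "v @ [t] = (v @ [t]) @ []" by auto
    then show ?thesis unfolding seed0_def by blast
  qed
qed

lemma seed0_Nil: "seed0 y z [] = {[y, z]}"
  by (auto simp: seed0_def)

lemma words_shift2:
  "even (length v) \<Longrightarrow> p @ z # v @ q \<in> words L b \<longleftrightarrow> p @ v @ z # q \<in> words L b"
proof (induction v arbitrary: p rule: induct_list012)
  case (3 a c v)
  have "p @ z # a # c # v @ q \<in> words L b \<longleftrightarrow> p @ a # c # z # v @ q \<in> words L b"
    by (rule words_rot)
  also have "\<dots> \<longleftrightarrow> (p @ [a, c]) @ v @ z # q \<in> words L b"
    using 3(1)[of "p @ [a, c]"] 3(3) by simp
  finally show ?case by simp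
qed auto

lemma seed0_words:
  "y # z # v \<in> words L b \<Longrightarrow> seed0 y z v \<subseteq> words L b"
proof (induction v arbitrary: L b rule: rev_induct)
  case Nil
  then show ?case by (simp add: seed0_Nil)
next
  case (snoc t v)
  then have "t \<in> L" by (auto simp: words_def)
  then obtain b' where b': "\<And>u. u @ [t] \<in> words L b \<longleftrightarrow> u \<in> words (L - {t}) b'"
    using words_snoc by blast
  have IH: "seed0 y z v \<subseteq> words (L - {t}) b'"
    using snoc b'[of "y # z # v"] by simp
  have "v @ [y, z] \<in> seed0 y z v" unfolding seed0_def by auto
  then have "v @ [y, z] @ [t] \<in> words L b" using IH b'[of "v @ [y, z]"] by auto
  then have "v @ [z, t, y] \<in> words L b" "v @ [t, y, z] \<in> words L b"
    using words_rot[of v t y z "[]" L b] words_rot'[of v z t y "[]" L b] by simp_all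
  then show ?case using IH b' by (auto simp: seed0_snoc)
qed

lemma seed_words:
  assumes "y # z # v \<in> words L b" "even (length v)"
  shows "seed y z v \<subseteq> words L b"
  using seed0_words[OF assms(1)] words_shift2[OF assms(2), of "[y]" z "[]" L b] assms(1)
  by (simp add: seed_def)

lemma seed_last_notin_seed0:
  assumes "distinct (y # z # v)" "v \<noteq> []"
  shows "y # v @ [z] \<notin> seed0 y z v"
proof
  assume "y # v @ [z] \<in> seed0 y z v"
  then consider v1 v2 where "y # v @ [z] = v1 @ [y, z] @ v2" "v = v1 @ v2"
    | v1 x v2 where "y # v @ [z] = v1 @ [z, x, y] @ v2" "v = v1 @ x # v2"
    unfolding seed0_def by blast
  then show False
  proof cases
    case 1
    then show False using assms by (cases v1; cases v2) auto
  next
    case 2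
    then show False using assms by (cases v1) auto
  qed
qed

lemma grow_seed_base:
  assumes w: "[y, z, s, t] \<in> words L b"
  shows "grow (seed y z [s, t]) (words L b)"
proof -
  have ne: "y \<noteq> z" "y \<noteq> s" "y \<noteq> t" "z \<noteq> y" "z \<noteq> s" "z \<noteq> t" "s \<noteq> y" "s \<noteq> z" "s \<noteq> t"
    "t \<noteq> y" "t \<noteq> z" "t \<noteq> s" using w by (auto simp: words_def)
  have S: "seed y z [s, t] = {[y, s, t, z], [y, z, s, t], [z, s, y, t], [s, y, z, t], [s, z, t, y], [s, t, y, z]}"
    using seed0_snoc[of y z "[s]" t] seed0_snoc[of y z "[]" s] by (simp add: seed_def seed0_Nil insert_commute)
  define D1 where "D1 = seed y z [s, t] \<union> {[z, t, s, y], [z, y, t, s]}"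
  define D2 where "D2 = D1 \<union> {[t, z, y, s], [y, t, z, s]}"
  have g1: "grow (seed y z [s, t]) D1"
    by (rule grow_step[of "[z]" s y t "[]"]) (simp_all add: S D1_def ne)
  have g2: "grow D1 D2"
    by (rule grow_step[of "[]" z y t "[s]"]) (simp_all add: S D1_def D2_def ne)
  have g3: "grow D2 (D2 \<union> {[t, s, z, y], [t, y, s, z]})"
    by (rule grow_step[of "[t]" z y s "[]"]) (simp_all add: S D1_def D2_def ne)
  have "D2 \<union> {[t, s, z, y], [t, y, s, z]} = words L b"
    unfolding words4[OF w] tri_def D2_def D1_def S by auto
  with rtranclp_trans[OF g1 rtranclp_trans[OF g2 g3]] show ?thesis by simp
qed

text \<open>Removing two letters \<open>s\<close>, \<open>t\<close> at a time keeps the length even.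
  The difficulty is to provide two close words in each block before it is filled, and never to be
  left with a single missing block. Here \<open>v = a @ [s, t]\<close>.\<close>

lemma grow_seed:
  "\<lbrakk>even (length v); v \<noteq> []; y # z # v \<in> words L b\<rbrakk> \<Longrightarrow> grow (seed y z v) (words L b)"
proof (induction "length v" arbitrary: v L b rule: less_induct)
  case less
  obtain v' t where v': "v = v' @ [t]" using less.prems(2) by (cases v rule: rev_cases) auto
  with less.prems(1) obtain a s where v'': "v' = a @ [s]" by (cases v' rule: rev_cases) auto
  have v: "v = a @ [s, t]" by (simp add: v' v'')
  have even_a: "even (length a)" using less.prems(1) v by simp
  show ?case
  proof (cases "a = []")
    case True
    with less.prems(3) v show ?thesis by (simp add: grow_seed_base)
  next
    case False
    with even_a have len_a: "length a \<ge> 2" by (cases a rule: remdups_adj.cases) auto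
    then obtain g g' f where a1: "a = g # g' # f" by (cases a rule: remdups_adj.cases) auto
    obtain w c d where a2: "a = w @ [c, d]"
    proof -
      obtain a' d where "a = a' @ [d]" using False by (cases a rule: rev_cases) auto
      moreover with len_a obtain w c where "a' = w @ [c]" by (cases a' rule: rev_cases) auto
      ultimately show ?thesis using that by simp
    qed
    have dist: "distinct (y # z # a @ [s, t])" and L: "L = set (y # z # a @ [s, t])"
      using less.prems(3) v by (auto simp: words_def)
    have fin: "finite L" using L by simp
    have card_L: "card L = length a + 4"
      using length_words[OF less.prems(3)] v by simp
    have ne: "s \<noteq> t" "s \<noteq> y" "s \<noteq> z" "t \<noteq> s" "t \<noteq> y" "t \<noteq> z" "y \<noteq> s" "y \<noteq> t" "y \<noteq> z"
      "z \<noteq> s" "z \<noteq> t" "z \<noteq> y" using dist by auto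
    have tL: "t \<in> L" and zL: "z \<in> L" and sL: "s \<in> L - {t}" using L ne by auto
    obtain b1 where b1: "\<And>u. u @ [t] \<in> words L b \<longleftrightarrow> u \<in> words (L - {t}) b1"
      using words_snoc[OF tL] by blast
    obtain b2 where b2: "\<And>u. u @ [s] \<in> words (L - {t}) b1 \<longleftrightarrow> u \<in> words (L - {t} - {s}) b2"
      using words_snoc[OF sL] by blast
    obtain b3 where b3: "\<And>u. u @ [z] \<in> words L b \<longleftrightarrow> u \<in> words (L - {z}) b3"
      using words_snoc[OF zL] by blast
    have b12: "u @ [s, t] \<in> words L b \<longleftrightarrow> u \<in> words (L - {t} - {s}) b2" for u
      using b1[of "u @ [s]"] b2[of u] by simp
    have seed_v_words: "seed y z v \<subseteq> words L b" by (rule seed_words) (use less.prems in auto)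
    define S where "S = seed y z a"
    have yza: "y # z # a \<in> words (L - {t} - {s}) b2"
      using less.prems(3) b12[of "y # z # a"] v by simp
    have S_words: "S \<subseteq> words (L - {t} - {s}) b2"
      unfolding S_def by (rule seed_words[OF yza even_a])
    have seed_v: "seed y z v = {y # a @ [s, t, z]} \<union> (\<lambda>u. u @ [s, t]) ` seed0 y z a \<union>
       {a @ [z, s, y, t], a @ [s, y, z, t], a @ [s, z, t, y], a @ [s, t, y, z]}"
    proof -
      have "seed0 y z v = (\<lambda>u. u @ [s, t]) ` seed0 y z a \<union>
          {a @ [z, s, y, t], a @ [s, y, z, t], a @ [s, z, t, y], a @ [s, t, y, z]}"
        using seed0_snoc[of y z "a @ [s]" t] seed0_snoc[of y z a s]
        by (simp add: v image_Un image_image insert_commute)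
      then show ?thesis unfolding seed_def by (simp add: v insert_commute)
    qed
    \<comment> \<open>The words ending in \<open>s\<close>, \<open>t\<close> come from
      \<open>seed0 y z a\<close> only. This rotation supplies the lacking
      \<open>y # a @ [z, s, t]\<close>, so that the induction hypothesis applies to the
      block.\<close>
    define D1 where "D1 = seed y z v \<union> {y # a @ [z, s, t], y # a @ [t, z, s]}"
    have g1: "grow (seed y z v) D1"
    proof (rule grow_step[of "y # a" s t z "[]"])
      have "y # a @ [z] \<notin> seed0 y z a"
        by (rule seed_last_notin_seed0) (use dist False in auto)
      then show "(y # a) @ [z, s, t] @ [] \<notin> seed y z v"
        using ne by (auto simp: seed_v)
      show "(y # a) @ [t, z, s] @ [] \<notin> seed y z v"
        using ne by (auto simp: seed_v)
      show "(y # a) @ [s, t, z] @ [] \<in> seed y z v" by (simp add: seed_v)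
    qed (simp add: D1_def)
    have D1_words: "D1 \<subseteq> words L b" by (rule grow_words[OF g1 seed_v_words])
    define X where "X = {a @ [s, z, t, y], a @ [s, t, y, z], y # a @ [s, t, z], y # a @ [t, z, s]}"
    have D1: "D1 = (\<lambda>u. u @ [s, t]) ` S \<union> {a @ [z, s, y, t], a @ [s, y, z, t]} \<union> X"
    proof -
      have "(\<lambda>u. u @ [s, t]) ` S = insert (y # a @ [z, s, t]) ((\<lambda>u. u @ [s, t]) ` seed0 y z a)"
        by (simp add: S_def seed_def)
      then show ?thesis unfolding D1_def seed_v X_def by blast
    qed
    have X_words: "X \<subseteq> words L b" using D1_words D1 by blast
    define T where "T = words (L - {t} - {s}) b2"
    have g2: "grow D1 (D1 \<union> (\<lambda>u. u @ [s, t]) ` T)"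
    proof (rule grow_block)
      have "{u. u @ [s, t] \<in> D1} = S" using ne by (auto simp: D1 X_def)
      moreover have "grow S T" unfolding S_def T_def
        by (rule less.hyps) (use False even_a yza v in auto)
      ultimately show "grow {u. u @ [s, t] \<in> D1} T" by simp
    qed
    define D2 where "D2 = (\<lambda>u. u @ [s, t]) ` T \<union> {a @ [z, s, y, t], a @ [s, y, z, t]} \<union> X"
    have D2: "D1 \<union> (\<lambda>u. u @ [s, t]) ` T = D2"
      using image_mono[OF S_words, of "\<lambda>u. u @ [s, t]"] unfolding D1 D2_def T_def by blast
    have D2_words: "D2 \<subseteq> words L b" using grow_words[OF g2 D1_words] D2 by simp
    have card1: "card (L - {t}) = Suc (length a + 2)" using tL fin card_L by simp
    have fin1: "finite (L - {t})" using fin by simp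
    have k1: "growable (length a + 2)" by (rule growable) (use len_a in simp)
    have D2_t: "{u. u @ [t] \<in> D2} = ending (L - {t}) b1 {s} \<union> {a @ [s, y, z], a @ [z, s, y]}"
    proof -
      have "ending (L - {t}) b1 {s} = (\<lambda>u. u @ [s]) ` T"
        unfolding T_def using ending_single[OF b2] by simp
      moreover have "u @ [t] \<in> (\<lambda>u. u @ [s, t]) ` T \<longleftrightarrow> u \<in> (\<lambda>u. u @ [s]) ` T" for u
        by auto
      then have "u @ [t] \<in> D2 \<longleftrightarrow> u \<in> (\<lambda>u. u @ [s]) ` T \<or> u = a @ [z, s, y] \<or> u = a @ [s, y, z]" for u
        unfolding D2_def X_def by (simp add: ne) blast
      ultimately show ?thesis by blast
    qed
    have g3: "grow {u. u @ [t] \<in> D2} (words (L - {t}) b1)"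
    proof -
      have "a @ [y, z, s, t] \<in> words L b"
      proof -
        have "a @ [s, y, z, t] \<in> words L b" using D1_words D1 by blast
        then show ?thesis using words_rot[of a s y z "[t]" L b] by simp
      qed
      then have "a @ [y, z, s] \<in> words (L - {t}) b1" using b1[of "a @ [y, z, s]"] by simp
      note in_words = this
      \<comment> \<open>The two seed words in the block of \<open>t\<close> that do not end in
        \<open>s\<close>, \<open>t\<close> are exactly the first half of attaching \<open>y\<close>
        and \<open>z\<close>, with \<open>p = a\<close>.\<close>
      have 1: "grow {u. u @ [t] \<in> D2} (ending (L - {t}) b1 ({s} \<union> {y, z}))"
        unfolding D2_t
      proof (rule grow_half_pair[OF k1 fin1 card1 _ _ _ _ a2 in_words])
        show "{s} \<subseteq> L - {t}" "y \<in> L - {t} - {s}" "z \<in> L - {t} - {s}" "s \<in> {s}"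
          unfolding L using ne by simp_all
      qed
      have 2: "grow (ending (L - {t}) b1 ({s} \<union> {y, z})) (words (L - {t}) b1)"
      proof (rule grow_fill[OF k1 _ fin1 card1])
        have "L - {t} - ({s} \<union> {y, z}) = set a" unfolding L using dist by auto
        then have "card (L - {t} - ({s} \<union> {y, z})) = length a"
          using dist distinct_card[of a] by simp
        then show "card (L - {t} - ({s} \<union> {y, z})) \<noteq> 1" using len_a by simp
        show "{s} \<union> {y, z} \<subseteq> L - {t}" unfolding L using ne by simp
      qed (use len_a in simp_all)
      show ?thesis using 1 2 by (rule rtranclp_trans)
    qed
    note g3' = grow_block[OF g3]
    define D3 where "D3 = ending L b {t} \<union> X"
    have D3: "D2 \<union> (\<lambda>u. u @ [t]) ` words (L - {t}) b1 = D3"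
    proof -
      have "D2 - X \<subseteq> ending L b {t}" using D2_words by (auto simp: D2_def ending_def)
      moreover have "X \<subseteq> D2" by (auto simp: D2_def)
      ultimately show ?thesis unfolding ending_single[OF b1] D3_def by blast
    qed
    \<comment> \<open>In \<open>X\<close> the blocks of \<open>y\<close> and \<open>s\<close> have
      one word each. \<open>w1\<close> is \<open>y # a\<close> with its first three letters rotated,
      and \<open>w2\<close> is \<open>a @ [s]\<close> with its last three letters rotated; so
      rotations behind \<open>w1\<close> and \<open>w2\<close> give these blocks a second word close
      to the first.\<close>
    define w1 where "w1 = g' # y # g # f"
    define w2 where "w2 = w @ [s, c, d]"
    have w1: "w1 @ [z, s, t] \<in> words L b"
    proof -
      have "y # a @ [z, s, t] \<in> words L b" using D1_words by (auto simp: D1_def)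
      then show ?thesis using words_rot[of "[]" g' y g "f @ [z, s, t]" L b] by (simp add: w1_def a1)
    qed
    have w2: "w2 @ [y, z, t] \<in> words L b"
    proof -
      have "a @ [s, y, z, t] \<in> words L b" using D1_words D1 by blast
      then show ?thesis using words_rot[of w s c d "[y, z, t]" L b] by (simp add: w2_def a2)
    qed
    define D4 where "D4 = D3 \<union> {w1 @ [t, z, s], w1 @ [s, t, z]}"
    define D5 where "D5 = D4 \<union> {w2 @ [t, y, z], w2 @ [z, t, y]}"
    have "y \<noteq> g'" using dist a1 by auto
    then have neq1: "w1 \<noteq> y # a" by (simp add: w1_def)
    have "s \<noteq> c" using dist a2 by auto
    then have neq2: "w2 \<noteq> a @ [s]" by (simp add: w2_def a2)
    note neq = neq1 neq2
    have g4: "grow D3 D4"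
    proof (rule grow_step[of w1 z s t "[]"])
      show "w1 @ [z, s, t] @ [] \<in> D3" using w1 by (auto simp: D3_def ending_def)
      show "w1 @ [t, z, s] @ [] \<notin> D3" "w1 @ [s, t, z] @ [] \<notin> D3"
        using ne neq by (auto simp: D3_def ending_def X_def)
    qed (simp add: D4_def)
    have g5: "grow D4 D5"
    proof (rule grow_step[of w2 y z t "[]"])
      show "w2 @ [y, z, t] @ [] \<in> D4" using w2 by (auto simp: D4_def D3_def ending_def)
      show "w2 @ [t, y, z] @ [] \<notin> D4" "w2 @ [z, t, y] @ [] \<notin> D4"
        using ne neq by (auto simp: D4_def D3_def ending_def X_def)
    qed (simp add: D5_def)
    have D3_words: "D3 \<subseteq> words L b" using X_words by (auto simp: D3_def ending_def)
    have D5_words: "D5 \<subseteq> words L b" using grow_words[OF g5 grow_words[OF g4 D3_words]] .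
    have kL: "growable (length a + 3)" "card L = Suc (length a + 3)"
      using len_a card_L by (auto intro: growable)
    have g6: "grow D5 (D5 \<union> ending L b {y})"
    proof (rule grow_ending[OF kL(1) fin kL(2)])
      show "{u. u @ [y] \<in> D5} = {a @ [s, z, t], w2 @ [z, t]}"
        using ne by (auto simp: D5_def D4_def D3_def X_def ending_def)
      show "close (a @ [s, z, t]) (w2 @ [z, t])"
        using dist by (intro close_rot[of _ w c d s "[z, t]"]) (auto simp: a2 w2_def)
    qed (use L D5_words in auto)
    have g7: "grow (D5 \<union> ending L b {y}) (D5 \<union> ending L b {y} \<union> ending L b {s})"
    proof (rule grow_ending[OF kL(1) fin kL(2)])
      show "{u. u @ [s] \<in> D5 \<union> ending L b {y}} = {y # a @ [t, z], w1 @ [t, z]}"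
        using ne by (auto simp: D5_def D4_def D3_def X_def ending_def)
      show "close (y # a @ [t, z]) (w1 @ [t, z])"
        using dist by (intro close_rot[of _ "[]" y g g' "f @ [t, z]"]) (auto simp: a1 w1_def)
    qed (use L D5_words in \<open>auto simp: ending_def\<close>)
    define D7 where "D7 = D5 \<union> ending L b {y} \<union> ending L b {s}"
    \<comment> \<open>The block of \<open>z\<close> has received four words. Sorted by the letter
      before \<open>z\<close>, which is \<open>y\<close> or \<open>t\<close>, they form two close
      pairs, so this block is filled through its own sub-blocks.\<close>
    define Z where "Z = {a @ [s, t, y], y # a @ [s, t], w1 @ [s, t], w2 @ [t, y]}"
    have D7_z: "{u. u @ [z] \<in> D7} = Z"
      using ne by (auto simp: D7_def D5_def D4_def D3_def X_def Z_def ending_def)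
    have Z_words: "Z \<subseteq> words (L - {z}) b3"
    proof
      fix u assume "u \<in> Z"
      then have "u @ [z] \<in> D5" by (auto simp: D5_def D4_def D3_def X_def Z_def)
      then show "u \<in> words (L - {z}) b3" using D5_words b3 by blast
    qed
    have kz: "growable (length a + 2)" "card (L - {z}) = Suc (length a + 2)" "finite (L - {z})"
      using len_a card_L fin zL by (auto intro: growable)
    have g8: "grow Z (words (L - {z}) b3)"
    proof -
      have 1: "grow Z (Z \<union> ending (L - {z}) b3 {y})"
      proof (rule grow_ending[OF kz(1,3,2)])
        show "{u. u @ [y] \<in> Z} = {a @ [s, t], w2 @ [t]}" using ne by (auto simp: Z_def)
        show "close (a @ [s, t]) (w2 @ [t])"
          using dist by (intro close_rot[of _ w c d s "[t]"]) (auto simp: a2 w2_def)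
      qed (use L ne Z_words in auto)
      have 2: "grow (Z \<union> ending (L - {z}) b3 {y})
         (Z \<union> ending (L - {z}) b3 {y} \<union> ending (L - {z}) b3 {t})"
      proof (rule grow_ending[OF kz(1,3,2)])
        show "{u. u @ [t] \<in> Z \<union> ending (L - {z}) b3 {y}} = {y # a @ [s], w1 @ [s]}"
          using ne by (auto simp: Z_def ending_def)
        show "close (y # a @ [s]) (w1 @ [s])"
          using dist by (intro close_rot[of _ "[]" y g g' "f @ [s]"]) (auto simp: a1 w1_def)
      qed (use L ne Z_words in \<open>auto simp: ending_def\<close>)
      have 3: "Z \<union> ending (L - {z}) b3 {y} \<union> ending (L - {z}) b3 {t} = ending (L - {z}) b3 {y, t}"
        using Z_words by (auto simp: Z_def ending_def)
      have 4: "grow (ending (L - {z}) b3 {y, t}) (words (L - {z}) b3)"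
      proof (rule grow_fill[OF kz(1) _ kz(3,2)])
        have "L - {z} - {y, t} = set (a @ [s])" unfolding L using dist by auto
        then have "card (L - {z} - {y, t}) = length a + 1"
          using dist distinct_card[of "a @ [s]"] by simp
        then show "card (L - {z} - {y, t}) \<noteq> 1" using len_a by linarith
        show "{y, t} \<subseteq> L - {z}" unfolding L using ne by simp
      qed (use len_a in simp_all)
      show ?thesis using rtranclp_trans[OF 1 rtranclp_trans[OF 2[unfolded 3] 4]] .
    qed
    have g9: "grow D7 (D7 \<union> ending L b {z})"
      using grow_block[of "[z]" D7, unfolded D7_z, OF g8] unfolding ending_single[OF b3] .
    have D8: "D7 \<union> ending L b {z} = ending L b {t, y, s, z}"
    proof -
      have "D5 \<subseteq> ending L b {t, y, s, z}"
        using D5_words by (auto simp: D5_def D4_def D3_def X_def ending_def)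
      then show ?thesis by (auto simp: D7_def D5_def D4_def D3_def ending_def)
    qed
    have g10: "grow (ending L b {t, y, s, z}) (words L b)"
    proof (rule grow_fill[OF kL(1) _ fin kL(2)])
      have "L - {t, y, s, z} = set a" unfolding L using dist by auto
      then have "card (L - {t, y, s, z}) = length a" using dist distinct_card[of a] by simp
      then show "card (L - {t, y, s, z}) \<noteq> 1" using len_a by simp
      show "{t, y, s, z} \<subseteq> L" unfolding L by simp
    qed (use len_a in simp_all)
    note g1
    also note g2[unfolded D2]
    also note g3'[unfolded D3]
    also note g4
    also note g5
    also note g6
    also note g7[folded D7_def]
    also note g9[unfolded D8]
    also note g10
    finally show ?thesis .
  qed
qed

section \<open>Merging cycles\<close>

definition push :: "'a list \<Rightarrow> 'a list" where
  "push w = last w # butlast w"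

definition push3 :: "'a list \<Rightarrow> 'a list" where
  "push3 w = push (take (length w - 2) w) @ drop (length w - 2) w"

lemma push_snoc [simp]: "push (w @ [x]) = x # w"
  by (simp add: push_def)

lemma push3_append [simp]: "push3 (w @ [x, y, z]) = x # w @ [y, z]"
  using push_snoc[of w x] by (simp add: push3_def)

definition route :: "'a list set \<Rightarrow> 'a list \<Rightarrow> 'a list" where
  "route S w = (if w \<in> S then push3 w else push w)"

section \<open>Cycles of a map, and how they merge\<close>

abbreviation reach :: "('a \<Rightarrow> 'a) \<Rightarrow> 'a \<Rightarrow> 'a \<Rightarrow> bool" where
  "reach f \<equiv> (\<lambda>x y. y = f x)\<^sup>*\<^sup>*"

lemma reach_step: "reach f x (f x)"
  by auto

lemma reach_step_into: "reach f x y \<Longrightarrow> reach f x (f y)"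
  by (rule rtranclp.rtrancl_into_rtrancl) auto

text \<open>The path from a point under a map is unique: a return path from \<open>y\<close> to
  \<open>s\<close> passes through \<open>f y\<close> or is empty, and in the latter case the second
  assumption takes over.\<close>

lemma reach_back:
  assumes "reach f s x" "reach f (f s) s"
  shows "reach f x s"
  using assms
proof (induction rule: rtranclp_induct)
  case (step y z)
  then have "reach f y s" by simp
  then show ?case
  proof (cases rule: converse_rtranclpE)
    case base
    then show ?thesis using step by simp
  next
    case (step y')
    then show ?thesis using \<open>z = f y\<close> by simp
  qed
qed auto

text \<open>For finite nonempty \<open>C\<close> this says that \<open>f\<close> traverses
  \<open>C\<close> in a single cycle. Reachability is convenient for merging; the enumeration
  without repetition is recovered in \<open>cyc_enum\<close>.\<close>

definition cyc :: "('a \<Rightarrow> 'a) \<Rightarrow> 'a set \<Rightarrow> bool" where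
  "cyc f C \<longleftrightarrow> f ` C \<subseteq> C \<and> (\<forall>x\<in>C. \<forall>y\<in>C. reach f x y)"

text \<open>A change of the map at \<open>a\<close> alone opens the cycle into a path from
  \<open>f a\<close> to \<open>a\<close>.\<close>

lemma cyc_cut:
  assumes C: "cyc f C" "a \<in> C" and g: "\<And>x. x \<in> C \<Longrightarrow> x \<noteq> a \<Longrightarrow> g x = f x" and x: "x \<in> C"
  shows "reach g (f a) x" "reach g x a"
proof -
  have fa: "f a \<in> C" using C by (auto simp: cyc_def)
  have "reach g (f a) y \<and> y \<in> C" if "reach f (f a) y" for y
    using that
  proof (induction rule: rtranclp_induct)
    case (step y z)
    then have "z \<in> C" using C by (auto simp: cyc_def)
    moreover have "reach g (f a) z"
    proof (cases "y = a")
      case False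
      then have "z = g y" using step g by simp
      with step show ?thesis using reach_step_into[of g "f a" y] by simp
    qed (use step in auto)
    ultimately show ?case by simp
  qed (use fa in auto)
  moreover have "reach f (f a) x" using C fa x by (auto simp: cyc_def)
  ultimately show "reach g (f a) x" by blast
  have "reach f x a" using C x by (auto simp: cyc_def)
  then show "reach g x a" using x
  proof (induction rule: converse_rtranclp_induct)
    case (step y z)
    show ?case
    proof (cases "y = a")
      case False
      then have "g y = z" "z \<in> C" using step g C by (auto simp: cyc_def)
      then show ?thesis using step by (blast intro: converse_rtranclp_into_rtranclp)
    qed auto
  qed auto
qed

text \<open>Cut the cycles open at \<open>a\<close>, \<open>b\<close>, \<open>c\<close>; the new
  successors join the three paths in the order \<open>A\<close>, \<open>B\<close>,
  \<open>C\<close>.\<close>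

lemma cyc_merge:
  assumes A: "cyc f A" "a \<in> A" and B: "cyc f B" "b \<in> B" and C: "cyc f C" "c \<in> C"
    and g: "g a = f b" "g b = f c" "g c = f a"
    "\<And>x. x \<in> A \<union> B \<union> C \<Longrightarrow> x \<notin> {a, b, c} \<Longrightarrow> g x = f x"
    and disj: "A \<inter> B = {}" "A \<inter> C = {}" "B \<inter> C = {}"
  shows "cyc g (A \<union> B \<union> C)"
proof -
  have a: "reach g (f a) x" "reach g x a" if "x \<in> A" for x
    using cyc_cut[OF A, of g x] that A B C g(4) disj by blast+
  have b: "reach g (f b) x" "reach g x b" if "x \<in> B" for x
    using cyc_cut[OF B, of g x] that A B C g(4) disj by blast+
  have c: "reach g (f c) x" "reach g x c" if "x \<in> C" for x
    using cyc_cut[OF C, of g x] that A B C g(4) disj by blast+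
  have ab: "reach g a b" using b(1)[OF B(2)] reach_step[of g a] unfolding g by (rule rtranclp_trans[rotated])
  have bc: "reach g b c" using c(1)[OF C(2)] reach_step[of g b] unfolding g by (rule rtranclp_trans[rotated])
  have ca: "reach g c a" using a(1)[OF A(2)] reach_step[of g c] unfolding g by (rule rtranclp_trans[rotated])
  have to_a: "reach g x a" if "x \<in> A \<union> B \<union> C" for x
  proof -
    consider "x \<in> A" | "x \<in> B" | "x \<in> C" using \<open>x \<in> A \<union> B \<union> C\<close> by blast
    then show ?thesis
    proof cases
      case 2
      show ?thesis by (rule rtranclp_trans[OF b(2)[OF 2] rtranclp_trans[OF bc ca]])
    next
      case 3
      show ?thesis by (rule rtranclp_trans[OF c(2)[OF 3] ca])
    qed (rule a(2))
  qed
  have ac: "reach g a c" using ab bc by (rule rtranclp_trans)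
  have from_a: "reach g a x" if "x \<in> A \<union> B \<union> C" for x
  proof -
    consider "x \<in> A" | "x \<in> B" | "x \<in> C" using \<open>x \<in> A \<union> B \<union> C\<close> by blast
    then show ?thesis
    proof cases
      case 1
      show ?thesis by (rule rtranclp_trans[OF reach_step_into[OF ac, unfolded g] a(1)[OF 1]])
    next
      case 2
      show ?thesis by (rule rtranclp_trans[OF reach_step[of g a, unfolded g] b(1)[OF 2]])
    next
      case 3
      show ?thesis by (rule rtranclp_trans[OF reach_step_into[OF ab, unfolded g] c(1)[OF 3]])
    qed
  qed
  have "f a \<in> A" "f b \<in> B" "f c \<in> C" using A B C by (auto simp: cyc_def)
  then have "g x \<in> A \<union> B \<union> C" if "x \<in> A \<union> B \<union> C" for x
    using that A(1) B(1) C(1) g(1-3) g(4)[OF that] unfolding cyc_def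
    by (cases "x \<in> {a, b, c}") auto
  moreover have "reach g x y" if "x \<in> A \<union> B \<union> C" "y \<in> A \<union> B \<union> C" for x y
    using to_a[OF that(1)] from_a[OF that(2)] by (rule rtranclp_trans)
  ultimately show ?thesis unfolding cyc_def by blast
qed

text \<open>
  The cyclic word that reads \<open>u\<close> after the letter \<open>p\<close>, given by all its linear words.
\<close>

definition star :: "'a \<Rightarrow> 'a list set \<Rightarrow> 'a list set" where
  "star p D = {r @ p # s | r s. s @ r \<in> D}"

lemma star_iff:
  assumes "p \<notin> set r" "p \<notin> set s"
  shows "r @ p # s \<in> star p D \<longleftrightarrow> s @ r \<in> D"
proof
  assume "r @ p # s \<in> star p D"
  then obtain r' s' where *: "r @ p # s = r' @ p # s'" "s' @ r' \<in> D" by (auto simp: star_def)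
  then show "s @ r \<in> D" using assms by (auto simp: append_eq_append_conv2 Cons_eq_append_conv append_eq_Cons_conv)
qed (auto simp: star_def)

lemma star_Un: "star p (D \<union> E) = star p D \<union> star p E"
  by (auto simp: star_def)

lemma star_disjoint:
  assumes "\<And>u. u \<in> D \<union> E \<Longrightarrow> p \<notin> set u" "D \<inter> E = {}"
  shows "star p D \<inter> star p E = {}"
proof -
  have "w \<notin> star p E" if w: "w \<in> star p D" for w
  proof -
    obtain r s where rs: "w = r @ p # s" "s @ r \<in> D" using w by (auto simp: star_def)
    then have "p \<notin> set r" "p \<notin> set s" using assms(1)[of "s @ r"] by auto
    then show ?thesis using star_iff[of p r s E] rs assms(2) by auto
  qed
  then show ?thesis by blast
qed

lemma push_star: "push ` star p D \<subseteq> star p D"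
proof
  fix w assume "w \<in> push ` star p D"
  then obtain r s where w: "w = push (r @ p # s)" "s @ r \<in> D" by (auto simp: star_def)
  show "w \<in> star p D"
  proof (cases s rule: rev_cases)
    case Nil
    then have "w = [] @ p # r" "r @ [] \<in> D" using w by auto
    then show ?thesis unfolding star_def by blast
  next
    case (snoc s' x)
    then have "w = (x # r) @ p # s'" "s' @ (x # r) \<in> D"
      using w push_snoc[of "r @ p # s'" x] by auto
    then show ?thesis unfolding star_def by blast
  qed
qed

text \<open>Away from \<open>S\<close> the map is the rotation of words; every word is compared with
  the one that begins with \<open>p\<close>.\<close>

lemma cyc_star_single:
  assumes "S \<inter> star p {u} = {}"
  shows "cyc (route S) (star p {u})"
proof -
  have eq: "route S w = push w" if "w \<in> star p {u}" for w
    using that assms by (auto simp: route_def)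
  have 1: "reach (route S) (p # u) (r @ p # s)" if "s @ r = u" for r s
    using that
  proof (induction r arbitrary: s)
    case (Cons x r)
    then have "reach (route S) (p # u) (r @ p # (s @ [x]))" by simp
    moreover have "r @ p # (s @ [x]) \<in> star p {u}" using Cons unfolding star_def by force
    ultimately show ?case
      using reach_step_into[of "route S" "p # u" "r @ p # (s @ [x])"] eq push_snoc[of "r @ p # s" x]
      by simp
  qed auto
  have 2: "reach (route S) (r @ p # s) (p # u)" if "s @ r = u" for r s
    using that
  proof (induction s arbitrary: r rule: rev_induct)
    case Nil
    then have "r @ [p] \<in> star p {u}" unfolding star_def by force
    then show ?case using reach_step[of "route S" "r @ [p]"] eq Nil by simp
  next
    case (snoc x s)
    then have "r @ p # (s @ [x]) \<in> star p {u}" unfolding star_def by force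
    then have "reach (route S) (r @ p # (s @ [x])) ((x # r) @ p # s)"
      using reach_step[of "route S" "r @ p # (s @ [x])"] eq push_snoc[of "r @ p # s" x] by simp
    moreover have "reach (route S) ((x # r) @ p # s) (p # u)" by (rule snoc.IH) (use snoc in simp)
    ultimately show ?case by (rule rtranclp_trans)
  qed
  have "route S ` star p {u} \<subseteq> star p {u}" using eq push_star[of p "{u}"] by auto
  moreover have "reach (route S) w w'" if "w \<in> star p {u}" "w' \<in> star p {u}" for w w'
  proof -
    obtain r s where w: "w = r @ p # s" "s @ r = u" using \<open>w \<in> star p {u}\<close> unfolding star_def by blast
    obtain r' s' where w': "w' = r' @ p # s'" "s' @ r' = u"
      using \<open>w' \<in> star p {u}\<close> unfolding star_def by blast
    show ?thesis unfolding w(1) w'(1) by (rule rtranclp_trans[OF 2[OF w(2)] 1[OF w'(2)]])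
  qed
  ultimately show ?thesis unfolding cyc_def by blast
qed

text \<open>\<open>S\<close> holds the words at which \<open>U\<close> is taken, and
  \<open>X\<close> is left out of the cycle. Closure of \<open>S\<close> under rotation ensures that
  an old word chosen for a new turn has none yet: otherwise \<open>S\<close> would contain a rotated
  word that belongs to a new cyclic word.\<close>

definition routed :: "'a \<Rightarrow> 'a list set \<Rightarrow> 'a list set \<Rightarrow> 'a list set \<Rightarrow> bool" where
  "routed p X D S \<longleftrightarrow> X \<subseteq> S \<and> S \<subseteq> star p D \<and>
     (\<forall>w x y z. w @ [x, y, z] \<in> S \<longrightarrow> w @ [z, x, y] \<in> S) \<and> cyc (route S) (star p D - X)"

text \<open>
  A turn at each of the three words \<open>a\<close>, \<open>b\<close>, \<open>c\<close> permutes their successors cyclically, which merges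
  the cycle through \<open>a\<close> with the two new cyclic words.
\<close>

lemma routed_step:
  assumes S: "routed p X D S" and D: "grow1 D D'" "\<And>u. u \<in> D' \<Longrightarrow> p \<notin> set u"
  shows "\<exists>S'. S \<subseteq> S' \<and> routed p X D' S'"
  using D(1)
proof cases
  case (grow1 q x y z r)
  define a where "a = (r @ p # q) @ [x, y, z]"
  define b where "b = (r @ p # q) @ [z, x, y]"
  define c where "c = (r @ p # q) @ [y, z, x]"
  define ub where "ub = q @ [z, x, y] @ r"
  define uc where "uc = q @ [y, z, x] @ r"
  have D': "D' = D \<union> {ub} \<union> {uc}" using grow1 by (auto simp: tri_def ub_def uc_def)
  have pD: "\<And>u. u \<in> D \<union> {ub} \<union> {uc} \<Longrightarrow> p \<notin> set u" using D(2) D' by blast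
  have "ub \<notin> D" "uc \<notin> D" using grow1 by (auto simp: ub_def uc_def)
  moreover have "ub \<noteq> uc" using grow1 by (auto simp: ub_def uc_def)
  ultimately have disj: "star p D \<inter> star p {ub} = {}" "star p D \<inter> star p {uc} = {}"
    "star p {ub} \<inter> star p {uc} = {}"
    by (intro star_disjoint; use pD in auto)+
  have a: "a \<in> star p D" unfolding star_def a_def using grow1 by force
  have b: "b \<in> star p {ub}" unfolding star_def b_def ub_def by force
  have c: "c \<in> star p {uc}" unfolding star_def c_def uc_def by force
  have rot: "\<And>w x y z. w @ [x, y, z] \<in> S \<Longrightarrow> w @ [z, x, y] \<in> S"
    and XS: "X \<subseteq> S" "S \<subseteq> star p D" and cyc_S: "cyc (route S) (star p D - X)"
    using S by (auto simp: routed_def)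
  have "b \<notin> S" "c \<notin> S" using XS b c disj by blast+
  then have "a \<notin> S" using rot[of "r @ p # q" x y z] by (auto simp: a_def b_def)
  then have "a \<in> star p D - X" using a XS by blast
  define S' where "S' = S \<union> {a, b, c}"
  have "star p D' - X = (star p D - X) \<union> star p {uc} \<union> star p {ub}"
    using XS disj unfolding D' star_Un by blast
  moreover have "cyc (route S') ((star p D - X) \<union> star p {uc} \<union> star p {ub})"
  proof (rule cyc_merge[OF cyc_S \<open>a \<in> star p D - X\<close> _ c _ b])
    show "cyc (route S) (star p {uc})" "cyc (route S) (star p {ub})"
      by (rule cyc_star_single; use XS disj in blast)+
    show "route S' a = route S c"
      using \<open>c \<notin> S\<close> push_snoc[of "r @ p # q @ [y, z]" x] push3_append[of "r @ p # q" x y z]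
      by (simp add: route_def S'_def) (simp add: a_def c_def)
    show "route S' c = route S b"
      using \<open>b \<notin> S\<close> push_snoc[of "r @ p # q @ [z, x]" y] push3_append[of "r @ p # q" y z x]
      by (simp add: route_def S'_def) (simp add: b_def c_def)
    show "route S' b = route S a"
      using \<open>a \<notin> S\<close> push_snoc[of "r @ p # q @ [x, y]" z] push3_append[of "r @ p # q" z x y]
      by (simp add: route_def S'_def) (simp add: b_def a_def)
    show "route S' w = route S w" if "w \<notin> {a, c, b}" for w
      using that by (auto simp: route_def S'_def)
  qed (use disj in blast)+
  ultimately have "cyc (route S') (star p D' - X)" by simp
  moreover have "w @ [k, i, j] \<in> S'" if "w @ [i, j, k] \<in> S'" for w i j k
    using that rot unfolding S'_def by (auto simp: a_def b_def c_def)
  moreover have "S' \<subseteq> star p D'" using XS a b c unfolding S'_def D' star_Un by blast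
  ultimately have "routed p X D' S'" using XS by (auto simp: routed_def S'_def)
  moreover have "S \<subseteq> S'" by (auto simp: S'_def)
  ultimately show ?thesis by blast
qed

lemma routed_grow:
  assumes "grow D D'" "routed p X D S" "\<And>u. u \<in> D' \<Longrightarrow> p \<notin> set u"
  shows "\<exists>S'. S \<subseteq> S' \<and> routed p X D' S'"
  using assms
proof (induction rule: rtranclp_induct)
  case (step D1 D2)
  have "D1 \<subseteq> D2" using grow_mono[of D1 D2] step by blast
  then obtain S1 where S1: "S \<subseteq> S1" "routed p X D1 S1" using step by blast
  obtain S2 where "S1 \<subseteq> S2" "routed p X D2 S2"
    using routed_step[OF S1(2) step(2)] step.prems by blast
  with S1 show ?case by blast
qed auto


section \<open>The tour through the orbits of the seed\<close>

locale initial_route =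
  fixes p y z :: 'a and v :: "'a list"
  assumes distinct: "distinct (p # y # z # v)" and length_v: "length v \<ge> 2"
begin

abbreviation rots :: "'a list set" where "rots \<equiv> star p {v}"

definition omitted :: "'a list set" where
  "omitted = (\<lambda>w. w @ [y, z]) ` rots"

text \<open>The orbits of the rotation of the last three letters that meet \<open>omitted\<close>.\<close>

definition turns :: "'a list set" where
  "turns = {w @ [x, y, z] | w x. w @ [x] \<in> rots} \<union> {w @ [z, x, y] | w x. w @ [x] \<in> rots} \<union>
     {w @ [y, z, x] | w x. w @ [x] \<in> rots}"

text \<open>Waypoints of the tour. From \<open>start r\<close> it reaches
  \<open>start (rotate1 r)\<close> with exactly two turns, and the rotations of \<open>r\<close>
  come back to \<open>r\<close>. In \<open>path_exists\<close> the identity is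
  \<open>start [2..<n]\<close>.\<close>

definition start :: "'a list \<Rightarrow> 'a list" where "start r = z # r @ [y]"

lemma rots_props:
  assumes "r \<in> rots"
  shows "set r = insert p (set v)" "length r = Suc (length v)" "distinct r" "y \<notin> set r" "z \<notin> set r"
proof -
  obtain a b where "r = a @ p # b" "b @ a = v" using assms by (auto simp: star_def)
  then show "set r = insert p (set v)" "length r = Suc (length v)" "distinct r" "y \<notin> set r" "z \<notin> set r"
    using distinct by auto
qed

lemma rots_rotate1:
  assumes "x # r \<in> rots"
  shows "r @ [x] \<in> rots"
proof -
  obtain a b where ab: "x # r = a @ p # b" "b @ a = v" using assms by (auto simp: star_def)
  show ?thesis
  proof (cases a)
    case Nil
    then have "r @ [x] = v @ p # []" "[] @ v = v" using ab by auto
    then show ?thesis unfolding star_def by blast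
  next
    case (Cons x' a')
    then have "r @ [x] = a' @ p # (b @ [x])" "(b @ [x]) @ a' = v" using ab by auto
    then show ?thesis unfolding star_def by blast
  qed
qed

lemma rots_rotate1': "r @ [x] \<in> rots \<Longrightarrow> x # r \<in> rots"
  using push_star[of p "{v}"] push_snoc[of r x] by (metis image_subset_iff)

lemma rots_rotate: "r \<in> rots \<Longrightarrow> rotate n r \<in> rots"
proof (induction n)
  case (Suc n)
  then have "rotate n r \<noteq> []" by (auto simp: star_def)
  then obtain x s where "rotate n r = x # s" by (cases "rotate n r") auto
  with Suc show ?case using rots_rotate1[of x s] by simp
qed simp

lemma rots_rotate_ex:
  assumes "r \<in> rots" "r' \<in> rots"
  shows "\<exists>n. r' = rotate n r"
proof -
  obtain a b where r: "r = a @ p # b" "b @ a = v" using assms(1) by (auto simp: star_def)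
  obtain a' b' where r': "r' = a' @ p # b'" "b' @ a' = v" using assms(2) by (auto simp: star_def)
  have "rotate (length a) r = p # v" using rotate_append[of a "p # b"] r by simp
  moreover have "rotate (length (p # b')) (p # v) = r'"
    using rotate_append[of "p # b'" a'] r' by simp
  ultimately have "r' = rotate (length (p # b') + length a) r"
    by (simp only: rotate_rotate[symmetric])
  then show ?thesis by blast
qed

lemma turns_iff:
  "w @ [i, j, k] \<in> turns \<longleftrightarrow>
     j = y \<and> k = z \<and> w @ [i] \<in> rots \<or> i = z \<and> k = y \<and> w @ [j] \<in> rots \<or> i = y \<and> j = z \<and> w @ [k] \<in> rots"
  unfolding turns_def by auto

lemma turnsE:
  assumes "g \<in> turns"
  obtains w i j k where "g = w @ [i, j, k]"
  using assms unfolding turns_def by blast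

text \<open>In a turn \<open>y\<close> and \<open>z\<close> stand among the last three letters. This
  test certifies every step of the tour that is a plain push.\<close>

lemma turns_prefix:
  assumes "g = a @ b" "length b \<ge> 3" "y \<in> set a \<or> z \<in> set a"
  shows "g \<notin> turns"
proof
  assume g: "g \<in> turns"
  then obtain w t where w: "g = w @ t" "length t = 3" "y \<notin> set w" "z \<notin> set w"
  proof -
    obtain w i j k where ijk: "g = w @ [i, j, k]" using g by (rule turnsE)
    then have "y \<notin> set w \<and> z \<notin> set w"
      using g rots_props(4,5)[of "w @ [i]"] rots_props(4,5)[of "w @ [j]"] rots_props(4,5)[of "w @ [k]"]
      unfolding ijk turns_iff by auto
    then show ?thesis using that[of w "[i, j, k]"] ijk by simp
  qed
  then have "length a \<le> length w" using assms by (metis add_le_imp_le_right add_le_mono length_append nle_le)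
  then have "a = take (length a) w" using w assms(1) by (auto simp: append_eq_append_conv_if)
  then have "set a \<subseteq> set w" using set_take_subset[of "length a" w] by simp
  then show False using w assms(3) by blast
qed

lemma route_turn: "w @ [i, j, k] \<in> turns \<Longrightarrow> route turns (w @ [i, j, k]) = i # w @ [j, k]"
  by (simp add: route_def)

lemma route_push:
  "g = a @ b \<Longrightarrow> length b \<ge> 3 \<Longrightarrow> y \<in> set a \<or> z \<in> set a \<Longrightarrow> g = h @ [x] \<Longrightarrow> route turns g = x # h"
proof -
  assume "g = a @ b" "length b \<ge> 3" "y \<in> set a \<or> z \<in> set a" "g = h @ [x]"
  then have "g \<notin> turns" using turns_prefix[of g a b] by simp
  moreover have "push g = x # h" unfolding \<open>g = h @ [x]\<close> by (rule push_snoc)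
  ultimately show ?thesis by (simp add: route_def)
qed

lemma route_start:
  assumes "r \<in> rots"
  shows "route turns (start r) = y # z # r"
  unfolding start_def using rots_props[OF assms] length_v
  by (intro route_push[of _ "[z]" "r @ [y]" "z # r" y]) auto

lemma reach_first_part:
  assumes "s @ d \<in> rots" "s \<noteq> []"
  shows "reach (route turns) (y # z # s @ d) (d @ [y, z] @ s)"
  using assms
proof (induction d arbitrary: s)
  case (Cons x d)
  then have "reach (route turns) (y # z # (s @ [x]) @ d) (d @ [y, z] @ (s @ [x]))"
    by (intro Cons.IH) auto
  moreover have "route turns (d @ [y, z] @ (s @ [x])) = x # d @ [y, z] @ s"
    using Cons.prems by (intro route_push[of _ "d @ [y]" "z # s @ [x]"]) (cases s; auto)+
  ultimately show ?case
    using reach_step_into[of "route turns" "y # z # (s @ [x]) @ d" "d @ [y, z] @ (s @ [x])"] by simp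
qed simp

text \<open>A push at \<open>r @ [y, z, x]\<close> would produce the omitted word
  \<open>x # r @ [y, z]\<close>; the first turn avoids it and separates \<open>y\<close> from
  \<open>z\<close>.\<close>

lemma reach_second_part:
  assumes "x # r \<in> rots"
  shows "reach (route turns) (y # z # x # r) (y # r @ [z, x])"
    "reach (route turns) (y # z # x # r) (x # y # r @ [z])"
proof -
  have "reach (route turns) (y # z # [x] @ r) (r @ [y, z] @ [x])"
    by (rule reach_first_part) (use assms in auto)
  moreover have "route turns (r @ [y, z, x]) = y # r @ [z, x]"
    by (rule route_turn) (use rots_rotate1[OF assms] in \<open>simp add: turns_iff\<close>)
  ultimately show 1: "reach (route turns) (y # z # x # r) (y # r @ [z, x])"
    using reach_step_into[of "route turns" "y # z # [x] @ r" "r @ [y, z] @ [x]"] by simp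
  have "route turns (y # r @ [z, x]) = x # y # r @ [z]"
    using rots_props(2)[OF assms] length_v by (intro route_push[of _ "[y]" "r @ [z, x]"]) (cases r; auto)+
  then show "reach (route turns) (y # z # x # r) (x # y # r @ [z])"
    using reach_step_into[OF 1] by simp
qed

lemma reach_third_part:
  assumes "x # s @ d \<in> rots"
  shows "reach (route turns) (y # z # x # s @ d) (d @ [z, x, y] @ s)"
  using assms
proof (induction d arbitrary: s)
  case Nil
  have len: "length s \<ge> 2" using rots_props(2)[OF Nil] length_v by simp
  have "route turns (x # y # s @ [z]) = z # x # y # s"
    using len by (intro route_push[of _ "[x, y]" "s @ [z]"]) auto
  then show ?case using reach_step_into[OF reach_second_part(2)[OF Nil]] by simp
next
  case (Cons a d)
  then have "reach (route turns) (y # z # x # (s @ [a]) @ d) (d @ [z, x, y] @ (s @ [a]))"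
    by (intro Cons.IH) auto
  moreover have "route turns (d @ [z, x, y] @ (s @ [a])) = a # d @ [z, x, y] @ s"
    by (intro route_push[of _ "d @ [z]" "[x, y] @ s @ [a]"]) auto
  ultimately show ?case
    using reach_step_into[of "route turns" "y # z # x # (s @ [a]) @ d" "d @ [z, x, y] @ (s @ [a])"] by simp
qed

text \<open>A push at \<open>r' @ [z, x, y]\<close> would lead back to
  \<open>y # r' @ [z, x]\<close>, which the tour has passed before; the second turn leads to the
  next waypoint instead.\<close>

lemma reach_next_start:
  assumes "r \<in> rots"
  shows "reach (route turns) (y # z # r) (start (rotate1 r))"
proof -
  obtain x r' where r: "r = x # r'" using assms by (cases r) (auto simp: star_def)
  have "reach (route turns) (y # z # x # [] @ r') (r' @ [z, x, y] @ [])"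
    by (rule reach_third_part) (use assms r in auto)
  moreover have "route turns (r' @ [z, x, y]) = z # r' @ [x, y]"
    by (rule route_turn) (use rots_rotate1 assms r in \<open>simp add: turns_iff\<close>)
  ultimately show ?thesis
    using reach_step_into[of "route turns" "y # z # x # [] @ r'" "r' @ [z, x, y] @ []"]
    by (simp add: start_def r)
qed

lemma reach_from_start: "r \<in> rots \<Longrightarrow> reach (route turns) (start r) (y # z # r)"
  using reach_step[of "route turns" "start r"] route_start by simp

lemma reach_start_rotate:
  assumes "r \<in> rots"
  shows "reach (route turns) (start r) (start (rotate n r))"
proof (induction n)
  case (Suc n)
  have "rotate n r \<in> rots" using assms by (rule rots_rotate)
  then have "reach (route turns) (start (rotate n r)) (start (rotate (Suc n) r))"
    using rtranclp_trans[OF reach_from_start reach_next_start] by simp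
  with Suc show ?case by (rule rtranclp_trans)
qed simp

lemma reach_start_start:
  "r \<in> rots \<Longrightarrow> r' \<in> rots \<Longrightarrow> reach (route turns) (start r) (start r')"
  using rots_rotate_ex reach_start_rotate by metis


lemma star_rots: "b @ a = v \<Longrightarrow> a @ p # b \<in> rots"
  unfolding star_def by blast

text \<open>The five forms are the phases of the tour; the omitted words are those of the first form
  with empty \<open>s\<close>.\<close>

lemma star_seed_cases:
  assumes "w \<in> star p (seed y z v)"
  obtains s d where "w = d @ [y, z] @ s" "s @ d \<in> rots"
  | r where "w = start r" "r \<in> rots"
  | x s d where "w = d @ [z, x, y] @ s" "x # s @ d \<in> rots"
  | x r where "w = x # y # r @ [z]" "x # r \<in> rots"
  | x r where "w = y # r @ [z, x]" "x # r \<in> rots"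
proof -
  obtain a b where w: "w = a @ p # b" and ba: "b @ a \<in> seed y z v" using assms by (auto simp: star_def)
  from ba consider v1 v2 where "b @ a = v1 @ [y, z] @ v2" "v = v1 @ v2"
    | v1 x v2 where "b @ a = v1 @ [z, x, y] @ v2" "v = v1 @ x # v2" | "b @ a = y # v @ [z]"
    unfolding seed_def seed0_def by blast
  then show ?thesis
  proof cases
    case 1
    then consider t where "b = v1 @ [y, z] @ t" "v2 = t @ a" | "b = v1 @ [y]" "a = z # v2"
      | t where "v1 = b @ t" "a = t @ [y, z] @ v2"
      by (auto simp: append_eq_append_conv2 append_eq_Cons_conv Cons_eq_append_conv)
    then show ?thesis
    proof cases
      case (1 t)
      with \<open>v = v1 @ v2\<close> show ?thesis
        using that(1)[of "a @ p # v1" t] star_rots[of v1 "t @ a"] w by simp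
    next
      case 2
      with \<open>v = v1 @ v2\<close> show ?thesis
        using that(2)[of "v2 @ p # v1"] star_rots[of v1 v2] w by (simp add: start_def)
    next
      case (3 t)
      with \<open>v = v1 @ v2\<close> show ?thesis
        using that(1)[of t "v2 @ p # b"] star_rots[of "b @ t" v2] w star_rots by simp
    qed
  next
    case 2
    then consider t where "b = v1 @ [z, x, y] @ t" "v2 = t @ a" | "b = v1 @ [z, x]" "a = y # v2"
      | "b = v1 @ [z]" "a = [x, y] @ v2" | t where "v1 = b @ t" "a = t @ [z, x, y] @ v2"
      by (auto simp: append_eq_append_conv2 append_eq_Cons_conv Cons_eq_append_conv)
    then show ?thesis
    proof cases
      case (1 t)
      with \<open>v = v1 @ x # v2\<close> show ?thesis
        using that(3)[of "a @ p # v1" x t] star_rots[of v1 "x # t @ a"] w by simp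
    next
      case 2
      with \<open>v = v1 @ x # v2\<close> show ?thesis
        using that(5)[of "v2 @ p # v1" x] star_rots[of v1 "x # v2"] w by simp
    next
      case 3
      with \<open>v = v1 @ x # v2\<close> show ?thesis
        using that(4)[of x "v2 @ p # v1"] star_rots[of v1 "x # v2"] w by simp
    next
      case (4 t)
      with \<open>v = v1 @ x # v2\<close> show ?thesis
        using that(3)[of t x "v2 @ p # b"] star_rots[of "b @ t" "x # v2"] w by simp
    qed
  next
    case 3
    then consider "b = []" "a = y # v @ [z]" | t where "b = y # t" "t @ a = v @ [z]"
      by (auto simp: append_eq_Cons_conv)
    then show ?thesis
    proof cases
      case 1
      then show ?thesis using that(5)[of v p] star_rots[of "[]" v] w rots_rotate1' by simp
    next
      case (2 t)
      show ?thesis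
      proof (cases a rule: rev_cases)
        case Nil
        then show ?thesis using 2 that(4)[of p v] star_rots[of v "[]"] w by simp
      next
        case (snoc a' z')
        then have "z' = z" "t @ a' = v" using 2 by auto
        then show ?thesis using 2 snoc that(3)[of a' p t] star_rots[of "t @ a'" "[]"] w by simp
      qed
    qed
  qed
qed

lemma starI: "s @ r \<in> D \<Longrightarrow> w = r @ p # s \<Longrightarrow> w \<in> star p D"
  unfolding star_def by blast

lemma seedI:
  "v = v1 @ v2 \<Longrightarrow> v1 @ [y, z] @ v2 \<in> seed y z v"
  "v = v1 @ x # v2 \<Longrightarrow> v1 @ [z, x, y] @ v2 \<in> seed y z v"
  "y # v @ [z] \<in> seed y z v"
  unfolding seed_def seed0_def by blast+

lemma turns_star: "turns \<subseteq> star p (seed y z v)"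
proof
  fix g assume g: "g \<in> turns"
  have "\<exists>w x. w @ [x] \<in> rots \<and> (g = w @ [x, y, z] \<or> g = w @ [z, x, y] \<or> g = w @ [y, z, x])"
    using g unfolding turns_def by blast
  then obtain w x where wx: "w @ [x] \<in> rots" "g = w @ [x, y, z] \<or> g = w @ [z, x, y] \<or> g = w @ [y, z, x]"
    by blast
  obtain a b where ab: "w @ [x] = a @ p # b" "b @ a = v" using wx(1) by (auto simp: star_def)
  show "g \<in> star p (seed y z v)"
  proof (cases b rule: rev_cases)
    case Nil
    then have "x = p" "w = v" using ab by auto
    then show ?thesis
      using wx(2) seedI(1)[of "[]" v] seedI(1)[of v "[]"] seedI(3)
      by (auto intro: starI[of "[y, z]" v] starI[of "[y]" "v @ [z]"] starI[of "[]" "v @ [y, z]"])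
  next
    case (snoc b' x')
    then have "x' = x" "w = a @ p # b'" "v = b' @ x # a" using ab by auto
    then show ?thesis
      using wx(2) seedI(1)[of "b' @ [x]" a] seedI(1)[of b' "x # a"] seedI(2)[of b' x a]
      by (auto intro: starI[of "b' @ [x, y, z]" a] starI[of "b' @ [z, x, y]" a] starI[of "b' @ [y, z, x]" a])
  qed
qed

lemma reach_from_starts:
  assumes "w \<in> star p (seed y z v) - omitted"
  shows "\<exists>r\<in>rots. reach (route turns) (start r) w"
proof -
  have "w \<in> star p (seed y z v)" using assms by blast
  then show ?thesis
  proof (cases rule: star_seed_cases)
    case (1 s d)
    then have "s \<noteq> []" using assms by (auto simp: omitted_def)
    then show ?thesis
      using rtranclp_trans[OF reach_from_start reach_first_part] 1 by blast
  next
    case (2 r)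
    then show ?thesis by blast
  next
    case (3 x s d)
    then show ?thesis
      using rtranclp_trans[OF reach_from_start reach_third_part] by blast
  next
    case (4 x r)
    then show ?thesis
      using rtranclp_trans[OF reach_from_start reach_second_part(2)] by blast
  next
    case (5 x r)
    then show ?thesis
      using rtranclp_trans[OF reach_from_start reach_second_part(1)] by blast
  qed
qed

lemma reach_to_start:
  assumes r: "r \<in> rots" and "reach (route turns) (start r) w"
  shows "reach (route turns) w (start r)"
proof (rule reach_back[OF assms(2)])
  have "reach (route turns) (start (rotate1 r)) (start r)"
    using reach_start_start rots_rotate[OF r, of 1] r by simp
  then show "reach (route turns) (route turns (start r)) (start r)"
    using reach_next_start[OF r] route_start[OF r] by simp
qed

lemma route_turns_closed:
  assumes "w \<in> star p (seed y z v) - omitted"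
  shows "route turns w \<in> star p (seed y z v) - omitted"
proof
  show "route turns w \<in> star p (seed y z v)"
  proof (cases "w \<in> turns")
    case True
    then obtain g i j k where g: "w = g @ [i, j, k]" by (rule turnsE)
    \<comment> \<open>\<open>U\<close> at a turn has the same value as \<open>T\<close> at a
      rotation of its last three letters, which is again a turn.\<close>
    have "g @ [j, k, i] \<in> turns" using True unfolding g turns_iff by blast
    then have "push (g @ [j, k, i]) \<in> star p (seed y z v)"
      by (intro subsetD[OF push_star imageI] subsetD[OF turns_star])
    then show ?thesis using True push_snoc[of "g @ [j, k]" i] by (simp add: g route_def)
  next
    case False
    then have "route turns w = push w" by (simp add: route_def)
    then show ?thesis using subsetD[OF push_star imageI] assms by (metis DiffD1)
  qed
  show "route turns w \<notin> omitted"
  proof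
    assume "route turns w \<in> omitted"
    then obtain r where r: "route turns w = r @ [y, z]" "r \<in> rots" by (auto simp: omitted_def)
    obtain h r' where hr: "r = h # r'" using r(2) by (cases r) (auto simp: star_def)
    show False
    proof (cases "w \<in> turns")
      case True
      then obtain g i j k where g: "w = g @ [i, j, k]" by (rule turnsE)
      have "h # r' @ [y, z] = i # g @ [j, k]" using r(1) route_turn[of g i j k] True g hr by simp
      then have "w = (r' @ [h]) @ [y, z]" by (simp add: g)
      moreover have "r' @ [h] \<in> rots" using rots_rotate1 r(2) hr by simp
      ultimately have "w \<in> omitted" unfolding omitted_def by blast
      then show False using assms by blast
    next
      case False
      have "w \<noteq> []" using assms by (auto simp: star_def)
      then obtain g x where g: "w = g @ [x]" by (cases w rule: rev_cases) auto
      have "route turns w = x # g" using False g push_snoc[of g x] by (simp add: route_def)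
      then have "x # g = h # r' @ [y, z]" using r(1) hr by simp
      then have "w = r' @ [y, z, h]" by (simp add: g)
      moreover have "r' @ [h] \<in> rots" using rots_rotate1 r(2) hr by simp
      ultimately have "w \<in> turns" by (simp add: turns_iff)
      then show False using False by blast
    qed
  qed
qed

lemma routed_seed: "routed p omitted (seed y z v) turns"
  unfolding routed_def
proof (intro conjI allI impI)
  show "omitted \<subseteq> turns"
  proof
    fix w assume "w \<in> omitted"
    then obtain r where r: "w = r @ [y, z]" "r \<in> rots" by (auto simp: omitted_def)
    then have "r \<noteq> []" by (auto simp: star_def)
    then obtain r' x where "r = r' @ [x]" by (cases r rule: rev_cases) auto
    then show "w \<in> turns" using r by (simp add: turns_iff)
  qed
  show "turns \<subseteq> star p (seed y z v)" by (rule turns_star)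
  show "w @ [k, i, j] \<in> turns" if "w @ [i, j, k] \<in> turns" for w i j k
    using that unfolding turns_iff by blast
  show "cyc (route turns) (star p (seed y z v) - omitted)"
    unfolding cyc_def
  proof (intro conjI ballI)
    show "route turns ` (star p (seed y z v) - omitted) \<subseteq> star p (seed y z v) - omitted"
      using route_turns_closed by blast
    fix w w' assume w: "w \<in> star p (seed y z v) - omitted" "w' \<in> star p (seed y z v) - omitted"
    obtain r where r: "r \<in> rots" "reach (route turns) (start r) w" using reach_from_starts[OF w(1)] by blast
    obtain r' where r': "r' \<in> rots" "reach (route turns) (start r') w'" using reach_from_starts[OF w(2)] by blast
    show "reach (route turns) w w'"
      by (rule rtranclp_trans[OF reach_to_start[OF r]
          rtranclp_trans[OF reach_start_start[OF r(1) r'(1)] r'(2)]])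
  qed
qed

end

section \<open>The path in a cell\<close>

lemma cyc_enum:
  assumes C: "cyc f C" "s \<in> C"
  shows "bij_betw (\<lambda>i. (f ^^ i) s) {..<card C} C" "(f ^^ card C) s = s"
proof -
  have ex: "\<exists>i. y = (f ^^ i) x" if "reach f x y" for x y
    using that
  proof (induction rule: rtranclp_induct)
    case base
    show ?case by (rule exI[of _ 0]) simp
  next
    case (step y z)
    then obtain i where "y = (f ^^ i) x" by blast
    then have "z = (f ^^ Suc i) x" using step by simp
    then show ?case by blast
  qed
  have "reach f (f s) s" using C by (auto simp: cyc_def)
  then obtain i where i: "s = (f ^^ i) (f s)" using ex by blast
  have per: "0 < Suc i \<and> (f ^^ Suc i) s = s" using i[symmetric] by (simp add: funpow_swap1)
  define k where "k = (LEAST k. 0 < k \<and> (f ^^ k) s = s)"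
  have "0 < k \<and> (f ^^ k) s = s" unfolding k_def using per by (rule LeastI)
  then have k: "0 < k" "(f ^^ k) s = s" by blast+
  have least: "(f ^^ j) s \<noteq> s" if "0 < j" "j < k" for j
    using not_less_Least[of j "\<lambda>k. 0 < k \<and> (f ^^ k) s = s"] that unfolding k_def by blast
  have distinct: "(f ^^ i) s \<noteq> (f ^^ j) s" if "i < j" "j < k" for i j
  proof
    assume eq: "(f ^^ i) s = (f ^^ j) s"
    have "(f ^^ (k - j + i)) s = (f ^^ (k - j)) ((f ^^ i) s)"
      unfolding funpow_add by (rule o_apply)
    also have "\<dots> = (f ^^ (k - j + j)) s" unfolding eq funpow_add by (rule o_apply[symmetric])
    also have "k - j + j = k" using that by simp
    also have "(f ^^ k) s = s" by (rule k(2))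
    finally have "(f ^^ (k - j + i)) s = s" .
    moreover have "0 < k - j + i" "k - j + i < k" using that by linarith+
    ultimately show False using least[of "k - j + i"] by simp
  qed
  have "inj_on (\<lambda>i. (f ^^ i) s) {..<k}"
  proof (rule inj_onI)
    fix i j assume "i \<in> {..<k}" "j \<in> {..<k}" "(f ^^ i) s = (f ^^ j) s"
    then show "i = j" using distinct[of i j] distinct[of j i] by (cases i j rule: linorder_cases) auto
  qed
  moreover have "(\<lambda>i. (f ^^ i) s) ` {..<k} = C"
  proof (intro equalityI subsetI)
    fix x assume "x \<in> (\<lambda>i. (f ^^ i) s) ` {..<k}"
    then obtain i where "x = (f ^^ i) s" by blast
    moreover have "(f ^^ i) s \<in> C" for i
      using C by (induction i) (auto simp: cyc_def)
    ultimately show "x \<in> C" by simp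
  next
    fix x assume "x \<in> C"
    then have "reach f s x" using C by (auto simp: cyc_def)
    then obtain i where i: "x = (f ^^ i) s" using ex by blast
    also have "\<dots> = (f ^^ (i mod k)) s" using funpow_mod_eq[OF k(2), of i] by simp
    finally show "x \<in> (\<lambda>i. (f ^^ i) s) ` {..<k}" using k(1) by (intro image_eqI[of _ _ "i mod k"]) auto
  qed
  ultimately have bij: "bij_betw (\<lambda>i. (f ^^ i) s) {..<k} C" by (simp add: bij_betw_def)
  then have "card C = k" using bij_betw_same_card[OF bij] by simp
  with bij k(2) show "bij_betw (\<lambda>i. (f ^^ i) s) {..<card C} C" "(f ^^ card C) s = s" by simp_all
qed

text \<open>The exchange of the first two letters is a bijection between the two classes.\<close>

lemma card_words:
  assumes L: "finite L" "card L \<ge> 2"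
  shows "2 * card (words L b) = fact (card L)"
proof -
  define sw where "sw = (\<lambda>u :: nat list. u ! 1 # u ! 0 # drop 2 u)"
  have split: "\<exists>x y w. u = x # y # w" if "u \<in> words L b" for u b
    using length_words[OF that] L(2) by (cases u rule: remdups_adj.cases) auto
  have sw: "sw u \<in> words L (\<not> b) \<and> sw (sw u) = u" if "u \<in> words L b" for u b
  proof -
    obtain x y w where u: "u = x # y # w" using split \<open>u \<in> words L b\<close> by blast
    then have "sw u = y # x # w" "sw (y # x # w) = u" by (simp_all add: sw_def numeral_2_eq_2)
    then show ?thesis using that words_swap[of "[]" x y w L b] u by simp
  qed
  have "bij_betw sw (words L b) (words L (\<not> b))"
  proof (rule bij_betw_byWitness[where f' = sw])
    show "sw ` words L (\<not> b) \<subseteq> words L b" using sw[of _ "\<not> b"] by auto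
  qed (use sw[of _ b] sw[of _ "\<not> b"] in auto)
  then have "card (words L b) = card (words L (\<not> b))" by (rule bij_betw_same_card)
  moreover have "permutations_of_set L = words L b \<union> words L (\<not> b)"
    by (auto simp: permutations_of_set_def words_def)
  moreover have "words L b \<inter> words L (\<not> b) = {}" by (auto simp: words_def)
  ultimately show ?thesis
    using card_permutations_of_set[OF L(1)] card_Un_disjoint[of "words L b" "words L (\<not> b)"]
      finite_words by simp
qed

text \<open>For odd length the rotation by one letter is even. So all linear words of a cyclic word
  lie in the same class, and the cyclic word may be cut at any letter.\<close>

lemma words_append_commute:
  "odd (card L) \<Longrightarrow> r @ s \<in> words L b \<longleftrightarrow> s @ r \<in> words L b"
proof (induction r arbitrary: s)
  case (Cons x r)
  have "x # (r @ s) \<in> words L b \<longleftrightarrow> (r @ s) @ [x] \<in> words L b"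
  proof (cases "distinct (x # r @ s) \<and> set (x # r @ s) = L")
    case True
    then have "card L = Suc (length (r @ s))" using distinct_card[of "x # r @ s"] by simp
    with True Cons.prems show ?thesis using ipar_rotate1[of x "r @ s"] by (auto simp: words_def)
  qed (auto simp: words_def)
  then show ?case using Cons.IH[of "s @ [x]"] Cons.prems by simp
qed simp

lemma ipar_sorted: "sorted w \<Longrightarrow> ipar w"
proof (induction w)
  case (Cons x w)
  then have "filter (\<lambda>y. y < x) w = []" by (auto simp: filter_empty_conv)
  with Cons show ?case by (simp add: ipar.simps)
qed (simp add: ipar.simps)

lemma card_star_single:
  assumes "p \<notin> set v"
  shows "card (star p {v}) = Suc (length v)"
proof -
  have "star p {v} = (\<lambda>i. drop i v @ p # take i v) ` {..length v}"
  proof (intro equalityI subsetI)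
    fix w assume "w \<in> star p {v}"
    then obtain r s where "w = r @ p # s" "s @ r = v" by (auto simp: star_def)
    then show "w \<in> (\<lambda>i. drop i v @ p # take i v) ` {..length v}"
      by (intro image_eqI[of _ _ "length s"]) auto
  next
    fix w assume "w \<in> (\<lambda>i. drop i v @ p # take i v) ` {..length v}"
    then obtain i where "w = drop i v @ p # take i v" by blast
    moreover have "take i v @ drop i v = v" by simp
    ultimately show "w \<in> star p {v}" unfolding star_def by blast
  qed
  moreover have "inj_on (\<lambda>i. drop i v @ p # take i v) {..length v}"
  proof (rule inj_onI)
    fix i j assume ij: "i \<in> {..length v}" "j \<in> {..length v}"
      "drop i v @ p # take i v = drop j v @ p # take j v"
    have eq: "takeWhile (\<lambda>x. x \<noteq> p) (drop i v @ p # take i v) = drop i v" for i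
    proof -
      have "\<forall>x\<in>set (drop i v). x \<noteq> p" using assms by (auto dest: in_set_dropD)
      then show ?thesis by (simp add: takeWhile_tail)
    qed
    have "drop i v = drop j v" using eq[of i] eq[of j] ij(3) by simp
    then have "length v - i = length v - j" by (metis length_drop)
    then show "i = j" using ij by auto
  qed
  ultimately show ?thesis by (simp add: card_image)
qed

text \<open>Take \<open>p = 2\<close>, \<open>y = n\<close>, \<open>z = 1\<close>,
  \<open>v = [3..<n]\<close>: the omitted words are then the rotations of \<open>[2..<n]\<close>
  followed by \<open>n\<close>, \<open>1\<close>, and among them is the \<open>T\<close>-preimage of
  the identity. The cycle therefore enters the identity from its \<open>U\<close>-preimage, and
  cutting it there gives the path. The inequality \<open>n - 2 < fact n div 2\<close> records that
  the natural subtraction in the length is genuine.\<close>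

lemma path_exists:
  assumes n: "odd n" "n \<ge> 5"
  shows "\<exists>g. inj_on g {..<fact n div 2 - (n - 2)} \<and> n - 2 < fact n div 2 \<and>
     (\<forall>i<fact n div 2 - (n - 2). distinct (g i) \<and> set (g i) = {1..n} \<and> g i \<noteq> [2..<n + 1] @ [1]) \<and>
     g 0 = [1..<n + 1] \<and> g (fact n div 2 - (n - 2) - 1) = [2..<n - 1] @ [1, n - 1, n] \<and>
     (\<forall>i. Suc i < fact n div 2 - (n - 2) \<longrightarrow> g (Suc i) = push (g i) \<or> g (Suc i) = push3 (g i))"
proof -
  define v where "v = [3..<n]"
  define L where "L = {1..n} - {2}"
  have upt2: "[2..<n] = 2 # v"
    using n upt_conv_Cons[of 2 n] unfolding v_def by (simp add: eval_nat_numeral)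
  moreover have "[1..<n + 1] = [1..<n] @ [n]" "[1..<n] = 1 # [2..<n]"
    using n upt_Suc_append[of 1 n] upt_conv_Cons[of 1 n] by (simp_all add: eval_nat_numeral)
  ultimately have upt1: "[1..<n + 1] = [1] @ [2] @ v @ [n]" by simp
  have dist: "distinct (2 # n # 1 # v)" using n by (auto simp: v_def)
  have set_v: "set v = {3..<n}" by (simp add: v_def)
  interpret initial_route 2 n 1 v
    by unfold_locales (use dist n in \<open>auto simp: v_def\<close>)
  have odd_card: "odd (card {1..n})" using n by simp
  obtain b where b: "\<And>u. u @ [2] \<in> words {1..n} True \<longleftrightarrow> u \<in> words L b"
    using words_snoc[of 2 "{1..n}" True] n unfolding L_def by auto
  have even_v: "even (length v)" and v_ne: "v \<noteq> []" using n by (auto simp: v_def)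
  have id_words: "[1..<n + 1] \<in> words {1..n} True"
    using ipar_sorted[OF sorted_upt[of 1 "n + 1"]] by (auto simp: words_def simp del: upt_Suc)
  \<comment> \<open>The identity \<open>1, 2, v, n\<close> is rotated until \<open>2\<close> is
    last, and then \<open>n\<close> and \<open>1\<close> are moved across \<open>v\<close>, which
    has even length.\<close>
  have seed_start: "n # 1 # v \<in> words L b"
  proof -
    have "(v @ [n]) @ ([1] @ [2]) \<in> words {1..n} True"
      using id_words words_append_commute[OF odd_card, of "[1] @ [2]" "v @ [n]" True]
      unfolding upt1 by simp
    then have "v @ n # [1] \<in> words L b" using b[of "v @ [n, 1]"] by simp
    then have "n # v @ 1 # [] \<in> words L b"
      using words_shift2[OF even_v, of "[]" n "[1]" L b] by simp
    then show ?thesis using words_shift2[OF even_v, of "[n]" 1 "[]" L b] by simp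
  qed
  have "grow (seed n 1 v) (words L b)"
    by (rule grow_seed[OF even_v v_ne seed_start])
  moreover have "2 \<notin> set u" if "u \<in> words L b" for u
    using set_words[OF that] by (simp add: L_def)
  ultimately have "\<exists>S. turns \<subseteq> S \<and> routed 2 omitted (words L b) S"
    by (intro routed_grow[OF _ routed_seed])
  then obtain S where S: "turns \<subseteq> S" "routed 2 omitted (words L b) S" by blast
  have star: "star 2 (words L b) = words {1..n} True"
  proof -
    have iff: "r @ 2 # s \<in> words {1..n} True \<longleftrightarrow> s @ r \<in> words L b" for r s
      using words_append_commute[OF odd_card, of "r @ [2]" s True] b[of "s @ r"] by simp
    have "w \<in> star 2 (words L b)" if w: "w \<in> words {1..n} True" for w
    proof -
      have "2 \<in> set w" using set_words[OF w] n by auto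
      then obtain r s where "w = r @ 2 # s" by (auto dest: split_list)
      then show ?thesis using iff w unfolding star_def by blast
    qed
    moreover have "w \<in> words {1..n} True" if "w \<in> star 2 (words L b)" for w
      using that iff unfolding star_def by blast
    ultimately show ?thesis by blast
  qed
  define C where "C = words {1..n} True - omitted"
  define f where "f = route S"
  have C: "cyc f C" and om: "omitted \<subseteq> S" "S \<subseteq> words {1..n} True"
    using S(2) unfolding routed_def star C_def f_def by auto
  have card_om: "card omitted = n - 2"
  proof -
    have "inj_on (\<lambda>w. w @ [n, 1]) rots" by (auto simp: inj_on_def)
    then have "card omitted = card rots" unfolding omitted_def by (rule card_image)
    also have "\<dots> = n - 2" using card_star_single[of 2 v] dist n by (simp add: v_def)
    finally show ?thesis .
  qed
  have card_words_n: "card (words {1..n} True) = fact n div 2"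
    using card_words[of "{1..n}" True] n by simp
  have card_C: "card C = fact n div 2 - (n - 2)"
  proof -
    have "omitted \<subseteq> words {1..n} True" using om by blast
    then have "card C = card (words {1..n} True) - card omitted"
      unfolding C_def using finite_subset[OF _ finite_words] by (intro card_Diff_subset)
    then show ?thesis unfolding card_om card_words_n .
  qed
  have rot: "[2..<n] \<in> rots"
    unfolding upt2 using star_rots[of v "[]"] by simp
  have upt3: "[2..<n] = [2..<n - 1] @ [n - 1]" using n upt_Suc_append[of 2 "n - 1"] by simp
  define e where "e = [2..<n - 1] @ [1, n - 1, n]"
  have e_turns: "e \<in> turns" unfolding e_def turns_iff using rot upt3 by simp
  have e_C: "e \<in> C"
  proof -
    have "e \<notin> omitted"
    proof
      assume "e \<in> omitted"
      then obtain r where "e = r @ [n, 1]" unfolding omitted_def by blast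
      then have "last e = 1" by simp
      then show False using n by (simp add: e_def)
    qed
    then show ?thesis unfolding C_def using e_turns S(1) om(2) by blast
  qed
  have f_e: "f e = [1..<n + 1]"
  proof -
    have "[1..<n + 1] = 1 # [2..<n - 1] @ [n - 1, n]"
      using upt1 upt2 upt3 by simp
    moreover have "f e = push3 e" using e_turns S(1) by (auto simp: f_def route_def)
    moreover have "push3 e = 1 # [2..<n - 1] @ [n - 1, n]" unfolding e_def by (rule push3_append)
    ultimately show ?thesis by simp
  qed
  have s_C: "[1..<n + 1] \<in> C" 
    using e_C C unfolding cyc_def f_e[symmetric] by blast
  define g where "g = (\<lambda>i. (f ^^ i) [1..<n + 1])"
  have bij: "bij_betw g {..<card C} C" and per: "g (card C) = [1..<n + 1]"
    using cyc_enum[OF C s_C] by (simp_all add: g_def)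
  have g_Suc: "g (Suc i) = f (g i)" for i by (simp add: g_def)
  have finC: "finite C" unfolding C_def using finite_words by blast
  have pos: "card C > 0" using s_C finC by (auto simp: card_gt_0_iff)
  have g_in: "g i \<in> C" if "i < card C" for i using bij that by (auto simp: bij_betw_def)
  have g_last: "g (card C - 1) = e"
  proof -
    have "e \<in> g ` {..<card C}" using bij e_C unfolding bij_betw_def by blast
    then obtain i where i: "i < card C" "g i = e" by blast
    have "\<not> Suc i < card C"
    proof
      assume "Suc i < card C"
      moreover have "g (Suc i) = g 0" using i f_e by (simp add: g_Suc) (simp add: g_def)
      ultimately show False
        using inj_onD[OF bij_betw_imp_inj_on[OF bij], of "Suc i" 0] pos by simp
    qed
    then have "i = card C - 1" using i by simp
    then show ?thesis using i by simp
  qed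
  have last_om: "[2..<n + 1] @ [1] \<in> omitted"
  proof -
    have "[2..<n + 1] @ [1] = [2..<n] @ [n, 1]" using n upt_Suc_append[of 2 n] by simp
    then show ?thesis using rot unfolding omitted_def by blast
  qed
  show ?thesis
    unfolding card_C[symmetric]
  proof (intro exI[of _ g] conjI allI impI)
    show "inj_on g {..<card C}" using bij by (simp add: bij_betw_def)
    show "n - 2 < fact n div 2" using pos card_C by simp
    fix i assume i: "i < card C"
    show "distinct (g i)" "set (g i) = {1..n}" "g i \<noteq> [2..<n + 1] @ [1]"
      using g_in[OF i] last_om by (auto simp: C_def words_def)
  next
    show "g 0 = [1..<n + 1]" by (simp add: g_def)
    show "g (card C - 1) = [2..<n - 1] @ [1, n - 1, n]" using g_last by (simp add: e_def)
    fix i assume "Suc i < card C"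
    show "g (Suc i) = push (g i) \<or> g (Suc i) = push3 (g i)"
      by (simp add: g_Suc f_def route_def)
  qed
qed

section \<open>The code\<close>

text \<open>The value \<open>i\<close> beyond the end turns a word on \<open>n\<close> letters into
  a permutation of \<open>{1..n + 1}\<close> whose last symbol is \<open>n + 1\<close>.\<close>

definition vec :: "nat list \<Rightarrow> nat \<Rightarrow> nat" where
  "vec w i = (if 1 \<le> i \<and> i \<le> length w then w ! (i - 1) else i)"

lemma vec_permutes:
  assumes "distinct w" "set w = {1..n}" "n \<le> N"
  shows "vec w permutes {1..N}"
proof -
  have len: "length w = n" using distinct_card[OF assms(1)] assms(2) by simp
  have "inj_on (vec w) {1..n}"
  proof (rule inj_onI)
    fix i j assume ij: "i \<in> {1..n}" "j \<in> {1..n}" "vec w i = vec w j"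
    then have "w ! (i - 1) = w ! (j - 1)" by (simp add: vec_def len)
    then have "i - 1 = j - 1"
      using ij(1,2) len nth_eq_iff_index_eq[OF assms(1), of "i - 1" "j - 1"] by auto
    then show "i = j" using ij(1,2) by auto
  qed
  moreover have "vec w ` {1..n} \<subseteq> {1..n}"
  proof
    fix x assume "x \<in> vec w ` {1..n}"
    then obtain i where i: "1 \<le> i" "i \<le> n" "x = w ! (i - 1)" by (auto simp: vec_def len)
    then have "x \<in> set w" using len by simp
    then show "x \<in> {1..n}" using assms(2) by simp
  qed
  ultimately have "bij_betw (vec w) {1..n} {1..n}"
    by (simp add: bij_betw_def endo_inj_surj)
  then have "vec w permutes {1..n}"
    by (rule bij_imp_permutes) (auto simp: vec_def len)
  then show ?thesis by (rule permutes_subset) (use assms in auto)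
qed

lemma vec_inj:
  assumes "length w = length w'" "vec w = vec w'"
  shows "w = w'"
proof (rule nth_equalityI[OF assms(1)])
  fix i assume "i < length w"
  then show "w ! i = w' ! i" using fun_cong[OF assms(2), of "Suc i"] assms(1) by (simp add: vec_def)
qed

lemma vec_push:
  assumes "w \<noteq> []"
  shows "vec (push w) = push_top (length w) (vec w)"
proof -
  obtain u x where w: "w = u @ [x]" using assms by (cases w rule: rev_cases) auto
  show ?thesis
  proof
    fix i
    show "vec (push w) i = push_top (length w) (vec w) i"
      by (auto simp: w vec_def push_top_def nth_Cons' nth_append)
  qed
qed

lemma vec_push3:
  assumes "length w \<ge> 3"
  shows "vec (push3 w) = push_top (length w - 2) (vec w)"
proof -
  obtain u x y z where w: "w = u @ [x, y, z]"
  proof -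
    obtain a z where a: "w = a @ [z]" using assms by (cases w rule: rev_cases) auto
    moreover obtain b y where b: "a = b @ [y]" using assms a by (cases a rule: rev_cases) auto
    moreover obtain u x where "b = u @ [x]" using assms a b by (cases b rule: rev_cases) auto
    ultimately show ?thesis using that by simp
  qed
  show ?thesis
  proof
    fix i
    consider "i = 0" | "i = 1" | "2 \<le> i" "i \<le> length u + 1" | "i = length u + 2" | "i = length u + 3"
      | "i > length u + 3" by linarith
    then show "vec (push3 w) i = push_top (length w - 2) (vec w) i"
      by cases (auto simp: w vec_def push_top_def nth_Cons' nth_append)
  qed
qed

lemma vec_upt: "vec [1..<n + 1] = id"
  by (auto simp: vec_def fun_eq_iff simp del: upt_Suc)

text \<open>Transitions act on positions and \<open>s\<close> on symbols, so left translates of a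
  path are paths.\<close>

lemma push_top_comp: "s \<circ> push_top j a = push_top j (s \<circ> a)"
  by (auto simp: push_top_def fun_eq_iff)

lemma push_top_Suc: "j \<ge> 1 \<Longrightarrow> push_top (Suc j) id = transpose j (Suc j) \<circ> push_top j id"
  by (auto simp: push_top_def fun_eq_iff transpose_def)

lemma evenperm_permutes_comp:
  assumes "finite A" "p permutes A" "q permutes A"
  shows "evenperm (p \<circ> q) \<longleftrightarrow> (evenperm p \<longleftrightarrow> evenperm q)"
  using assms by (intro evenperm_comp permutes_imp_permutation)

text \<open>A transition of length \<open>j\<close> is a cycle of length \<open>j\<close>, built up
  here by one transposition at a time.\<close>

lemma push_top_perm: "j \<ge> 1 \<Longrightarrow> push_top j id permutes {1..j} \<and> (evenperm (push_top j id) \<longleftrightarrow> odd j)"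
proof (induction j rule: dec_induct)
  case base
  have eq: "push_top 1 id = id" by (rule ext) (simp add: push_top_def)
  show ?case unfolding eq by (intro conjI permutes_id) simp
next
  case (step j)
  have t: "transpose j (Suc j) permutes {1..Suc j}"
    using step.hyps by (intro permutes_swap_id) auto
  have p: "push_top j id permutes {1..Suc j}"
    by (rule permutes_subset[OF conjunct1[OF step.IH]]) simp
  have "evenperm (push_top (Suc j) id) \<longleftrightarrow> (evenperm (transpose j (Suc j)) \<longleftrightarrow> evenperm (push_top j id))"
    unfolding push_top_Suc[OF step.hyps(1)]
    by (rule evenperm_permutes_comp[OF finite_atLeastAtMost t p])
  moreover have "\<not> evenperm (transpose j (Suc j))" by (simp add: evenperm_swap)
  moreover have "push_top (Suc j) id permutes {1..Suc j}"
    unfolding push_top_Suc[OF step.hyps(1)] using p t by (rule permutes_compose)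
  ultimately show ?case using step.IH by (metis even_Suc)
qed

lemma push_top_permutes:
  assumes "a permutes {1..N}" "1 \<le> j" "j \<le> N"
  shows "push_top j a permutes {1..N}" "evenperm (push_top j a) \<longleftrightarrow> (evenperm a \<longleftrightarrow> odd j)"
proof -
  have eq: "push_top j a = a \<circ> push_top j id" using push_top_comp[of a j id] by simp
  have p: "push_top j id permutes {1..N}"
    by (rule permutes_subset[OF conjunct1[OF push_top_perm[OF assms(2)]]]) (use assms(3) in simp)
  show "push_top j a permutes {1..N}" unfolding eq using p assms(1) by (rule permutes_compose)
  have "evenperm (a \<circ> push_top j id) \<longleftrightarrow> (evenperm a \<longleftrightarrow> evenperm (push_top j id))"
    by (rule evenperm_permutes_comp[OF finite_atLeastAtMost assms(1) p])
  then show "evenperm (push_top j a) \<longleftrightarrow> (evenperm a \<longleftrightarrow> odd j)"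
    unfolding eq using push_top_perm[OF assms(2)] by blast
qed

theorem theorem40:
  fixes m :: nat
  assumes "m \<ge> 2"
  shows "\<exists>(M :: nat) (c :: nat \<Rightarrow> nat \<Rightarrow> nat).
           real M = real (2 * m) / real (2 * m + 2) * (fact (2 * m + 2) / 2)
                    - (2 * real m - 2) * (2 * real m) \<and>
           kendall_snake (2 * m + 2) M c"
proof -
  define n N where "n = 2 * m + 1" and "N = 2 * m + 2"
  have nN: "odd n" "n \<ge> 5" "N = Suc n" "even N" "2 * m = n - 1" using assms by (auto simp: n_def N_def)
  define K where "K = fact n div 2 - (n - 2)"
  obtain g where g_inj: "inj_on g {..<K}" and K_less: "n - 2 < fact n div 2"
    and g: "\<And>i. i < K \<Longrightarrow> distinct (g i)" "\<And>i. i < K \<Longrightarrow> set (g i) = {1..n}"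
      "\<And>i. i < K \<Longrightarrow> g i \<noteq> [2..<n + 1] @ [1]"
    and g_0: "g 0 = [1..<n + 1]" and g_last: "g (K - 1) = [2..<n - 1] @ [1, n - 1, n]"
    and g_Suc: "\<And>i. Suc i < K \<Longrightarrow> g (Suc i) = push (g i) \<or> g (Suc i) = push3 (g i)"
    using path_exists[OF nN(1,2)] unfolding K_def by blast
  have K: "K > 0" using K_less by (simp add: K_def)
  have len_g: "length (g i) = n" if "i < K" for i
    using distinct_card[OF g(1)[OF that]] g(2)[OF that] by simp
  have vec_perm: "vec (g i) permutes {1..N}" if "i < K" for i
    by (rule vec_permutes[OF g(1,2)[OF that]]) (use nN in simp)
  have vec_Suc: "\<exists>j. 1 < j \<and> j \<le> N \<and> odd j \<and> vec (g (Suc i)) = push_top j (vec (g i))"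
    if i: "Suc i < K" for i
  proof -
    have l: "length (g i) = n" using len_g i by simp
    from g_Suc[OF i] show ?thesis
    proof
      assume "g (Suc i) = push (g i)"
      then have "vec (g (Suc i)) = push_top n (vec (g i))"
        using vec_push[of "g i"] l nN(2) by fastforce
      then show ?thesis using nN by (intro exI[of _ n]) auto
    next
      assume "g (Suc i) = push3 (g i)"
      then have "vec (g (Suc i)) = push_top (n - 2) (vec (g i))"
        using vec_push3[of "g i"] l nN(2) by simp
      then show ?thesis using nN by (intro exI[of _ "n - 2"]) auto
    qed
  qed
  have vec_even: "evenperm (vec (g i))" if "i < K" for i
    using that
  proof (induction i)
    case 0
    show ?case unfolding g_0 vec_upt by simp
  next
    case (Suc i)
    obtain j where j: "1 < j" "j \<le> N" "odd j" "vec (g (Suc i)) = push_top j (vec (g i))"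
      using vec_Suc[OF Suc.prems] by blast
    then show ?case using push_top_permutes(2)[of "vec (g i)" N j] vec_perm[of i] Suc by simp
  qed
  define e where "e = vec (g (K - 1))"
  have e: "e i = (if 1 \<le> i \<and> i \<le> n - 3 then i + 1 else if i = n - 2 then 1 else i)" for i
  proof -
    have "length (g (K - 1)) = n" using K by (intro len_g) simp
    define r where "r = [2..<n - 1]"
    have len_r: "length r = n - 3" by (simp add: r_def)
    have e_nth: "e i = (r @ [1, n - 1, n]) ! (i - 1)" if "1 \<le> i" "i \<le> n"
      unfolding e_def vec_def unfolding \<open>length (g (K - 1)) = n\<close> unfolding g_last r_def
      using that by (simp only: if_True simp_thms)
    have end_nth: "(r @ [1, n - 1, n]) ! (length r + k) = [1, n - 1, n] ! k" for k
      by (rule nth_append_length_plus)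
    consider "i = 0 \<or> i > n" | "1 \<le> i" "i \<le> n - 3" | "i = n - 2" | "i = n - 1" | "i = n"
      using nN(2) by linarith
    then show ?thesis
    proof cases
      case 1
      then have "e i = i" unfolding e_def vec_def using \<open>length (g (K - 1)) = n\<close> by auto
      then show ?thesis using 1 nN(2) by auto
    next
      case 2
      then have "i - 1 < length r" unfolding len_r by linarith
      then have "(r @ [1, n - 1, n]) ! (i - 1) = r ! (i - 1)" by (simp add: nth_append)
      also have "\<dots> = i + 1" using 2 by (simp add: r_def)
      finally show ?thesis using 2 e_nth by simp
    next
      case 3
      then have "i - 1 = length r + 0" "1 \<le> i" "i \<le> n" using nN(2) len_r by linarith+
      then have "e i = 1" using e_nth end_nth[of 0] by (simp only:) simp
      then show ?thesis using 3 nN(2) by auto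
    next
      case 4
      then have "i - 1 = length r + 1" "1 \<le> i" "i \<le> n" using nN(2) len_r by linarith+
      then have "e i = n - 1" using e_nth end_nth[of 1] by (simp only:) simp
      then show ?thesis using 4 nN(2) by auto
    next
      case 5
      then have "i - 1 = length r + 2" "1 \<le> i" "i \<le> n" using nN(2) len_r by linarith+
      then have "e i = n" using e_nth end_nth[of 2] by (simp only:) simp
      then show ?thesis using 5 nN(2) by auto
    qed
  qed
  \<comment> \<open>In vector notation, \<open>e = [2, ..., n-2, 1, n-1, n, N]\<close>,
    \<open>\<pi> = [N, 2, ..., n-2, 1, n-1, n]\<close> and
    \<open>h = [n, N, 2, ..., n-2, 1, n-1]\<close>. The odd \<open>\<pi>\<close> lies between the
    cells, and \<open>h\<close> begins the second one.\<close>
  define \<pi> where "\<pi> = push_top N e"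
  define h where "h = push_top N \<pi>"
  have e_perm: "e permutes {1..N}" "evenperm e" using vec_perm vec_even K by (auto simp: e_def)
  have \<pi>_perm: "\<pi> permutes {1..N}" "\<not> evenperm \<pi>"
    using push_top_permutes[OF e_perm(1), of N] e_perm(2) nN by (auto simp: \<pi>_def)
  have h_perm: "h permutes {1..N}" "evenperm h"
    using push_top_permutes[OF \<pi>_perm(1), of N] \<pi>_perm(2) nN by (auto simp: h_def)
  have e_N: "e N = N" and e_n: "e n = n" and e_n1: "e (n - 1) = n - 1" and e_n2: "e (n - 2) = 1"
    unfolding e using nN(2,3) by auto
  have e_low: "e i = i + 1" if "1 \<le> i" "i \<le> n - 3" for i unfolding e using that by simp
  have \<pi>_1: "\<pi> 1 = N" unfolding \<pi>_def push_top_def using e_N by simp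
  have \<pi>_gt: "\<pi> i = e (i - 1)" if "1 < i" "i \<le> N" for i
    unfolding \<pi>_def push_top_def using that by simp
  have h_gt: "h i = \<pi> (i - 1)" if "1 < i" "i \<le> N" for i
    unfolding h_def push_top_def using that by simp
  have \<pi>_n: "\<pi> n = n - 1" using \<pi>_gt[of n] e_n1 nN(2,3) by simp
  have \<pi>_N: "\<pi> N = n" using \<pi>_gt[of N] e_n nN(2,3) by simp
  have h_1: "h 1 = n" unfolding h_def push_top_def using \<pi>_N by simp
  have h_2: "h 2 = N" using h_gt[of 2] \<pi>_1 nN(2,3) by simp
  have h_n: "h n = 1"
  proof -
    have "n - 1 - 1 = n - 2" by simp
    then show ?thesis using h_gt[of n] \<pi>_gt[of "n - 1"] e_n2 nN(2,3) by (simp only:)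
  qed
  have h_N: "h N = n - 1" using h_gt[of N] \<pi>_n nN(2,3) by simp
  have h_mid: "h i = i - 1" if "3 \<le> i" "i \<le> n - 1" for i
  proof -
    have "h i = \<pi> (i - 1)" using that nN(3) by (intro h_gt) linarith+
    also have "\<dots> = e (i - 1 - 1)" using that nN(3) by (intro \<pi>_gt) linarith+
    also have "\<dots> = i - 1 - 1 + 1" using that by (intro e_low) linarith+
    also have "\<dots> = i - 1" using that by simp
    finally show ?thesis .
  qed
  have pow_perm: "(h ^^ k) permutes {1..N}" "evenperm (h ^^ k)" for k
  proof -
    have "(h ^^ k) permutes {1..N} \<and> evenperm (h ^^ k)"
    proof (induction k)
      case 0
      show ?case unfolding funpow.simps by (intro conjI permutes_id) (simp only: evenperm_id)
    next
      case (Suc k)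
      then have "h \<circ> (h ^^ k) permutes {1..N}" using h_perm by (intro permutes_compose) auto
      moreover have "evenperm (h \<circ> (h ^^ k))"
        using evenperm_permutes_comp[OF finite_atLeastAtMost h_perm(1), of "h ^^ k"] Suc h_perm(2) by blast
      ultimately show ?case unfolding funpow.simps by blast
    qed
    then show "(h ^^ k) permutes {1..N}" "evenperm (h ^^ k)" by auto
  qed
  have pow_inj: "inj (h ^^ k)" for k using permutes_inj[OF pow_perm(1)] .
  \<comment> \<open>\<open>h\<close> exchanges \<open>1\<close> and \<open>n\<close> and moves the
    other symbols along the cycle \<open>N, n-1, n-2, ..., 2\<close> and back to \<open>N\<close>,
    of length \<open>2m\<close>.\<close>
  have pow_N: "(h ^^ k) N = n - k" if "1 \<le> k" "k \<le> n - 2" for k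
    using that
  proof (induction k rule: dec_induct)
    case base
    then show ?case using h_N by simp
  next
    case (step k)
    then have "(h ^^ Suc k) N = h (n - k)" by simp
    also have "\<dots> = n - k - 1" using step by (intro h_mid) auto
    finally show ?case by simp
  qed
  have pow_mid: "(h ^^ k) i = i - k" if "2 \<le> i" "i \<le> n - 1" "k \<le> i - 2" for i k
    using that(3)
  proof (induction k)
    case (Suc k)
    then have "(h ^^ Suc k) i = h (i - k)" by simp
    also have "\<dots> = i - k - 1" using Suc that by (intro h_mid) auto
    finally show ?case by simp
  qed simp
  have pow_n: "(h ^^ k) n \<in> {1, n}" for k
    by (induction k) (use h_1 h_n in auto)
  have pow_even: "(h ^^ (2 * k)) n = n \<and> (h ^^ (2 * k)) 1 = 1" for k
    by (induction k) (use h_1 h_n in auto)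
  have period: "h ^^ (2 * m) = id"
  proof
    fix i
    have N_to_2: "(h ^^ (n - 2)) N = 2" using pow_N[of "n - 2"] nN by simp
    consider "i \<notin> {1..N}" | "i = 1" | "i = n" | "i = N" | "2 \<le> i" "i \<le> n - 1" using nN by force
    then show "(h ^^ (2 * m)) i = id i"
    proof cases
      case 1
      then show ?thesis using permutes_not_in[OF pow_perm(1)] by simp
    next
      case 4
      have "2 * m = Suc (n - 2)" using nN by linarith
      then show ?thesis using N_to_2 h_2 4 by simp
    next
      case 5
      have "(h ^^ (i - 2)) i = 2" using pow_mid[of i "i - 2"] 5 by simp
      then have "(h ^^ Suc (i - 2)) i = N" using h_2 by simp
      moreover have "2 * m = (n - i) + Suc (i - 2)" using 5 nN by linarith
      ultimately have "(h ^^ (2 * m)) i = (h ^^ (n - i)) N" by (simp only: funpow_add o_apply)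
      also have "\<dots> = i" using pow_N[of "n - i"] 5 by simp
      finally show ?thesis by simp
    qed (use pow_even[of m] in auto)
  qed
  have pow_N_neq: "(h ^^ k) N \<notin> {1, n}" if "k < 2 * m" for k
    using pow_N[of k] that nN by (cases "k = 0") auto
  have pow_N_inj: "j = k" if "(h ^^ j) N = (h ^^ k) N" "j < 2 * m" "k < 2 * m" for j k
    using pow_N[of j] pow_N[of k] that nN by (cases "j = 0"; cases "k = 0") auto
  \<comment> \<open>Index \<open>K\<close> is the odd permutation behind the path of the cell; the
    next transition of length \<open>N\<close> gives \<open>h ^^ Suc q\<close>, the beginning of the
    next cell.\<close>
  define elem where "elem q i = (h ^^ q) \<circ> (if i < K then vec (g i) else \<pi>)" for q i
  have elem_perm: "elem q i permutes {1..N}" and elem_even: "evenperm (elem q i) \<longleftrightarrow> i < K" for q i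
  proof -
    define a where "a = (if i < K then vec (g i) else \<pi>)"
    have a: "a permutes {1..N}" "evenperm a \<longleftrightarrow> i < K"
      using vec_perm vec_even \<pi>_perm by (auto simp: a_def)
    have eq: "elem q i = (h ^^ q) \<circ> a" by (simp add: elem_def a_def)
    show "elem q i permutes {1..N}" unfolding eq using a(1) pow_perm(1) by (rule permutes_compose)
    show "evenperm (elem q i) \<longleftrightarrow> i < K"
      unfolding eq using evenperm_permutes_comp[OF finite_atLeastAtMost pow_perm(1) a(1), of q] a(2) pow_perm(2) by blast
  qed
  have elem_N: "elem q i N = (h ^^ q) N" if "i < K" for q i
    using that len_g[OF that] nN by (simp add: elem_def vec_def)
  have elem_inj: "q = q' \<and> i = i'"
    if eq: "elem q i = elem q' i'" and less: "q < 2 * m" "q' < 2 * m" "i \<le> K" "i' \<le> K" for q i q' i'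
  proof (cases "i < K")
    case True
    then have i': "i' < K" using elem_even[of q i] elem_even[of q' i'] eq by simp
    have "q = q'" using pow_N_inj[of q q'] elem_N[OF True, of q] elem_N[OF i', of q'] eq less by simp
    then have "vec (g i) = vec (g i')"
      using eq True i' pow_inj[of q] by (simp add: elem_def fun.inj_map_strong inj_eq fun_eq_iff)
    then have "g i = g i'" using vec_inj len_g True i' by metis
    then have "i = i'" using inj_onD[OF g_inj] True i' by blast
    with \<open>q = q'\<close> show ?thesis by simp
  next
    case False
    then have i': "\<not> i' < K" using elem_even[of q i] elem_even[of q' i'] eq by simp
    have "(h ^^ q) N = (h ^^ q') N"
      using fun_cong[OF eq, of 1] False i' \<pi>_1 by (simp add: elem_def)
    then show ?thesis using pow_N_inj less False i' by simp
  qed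
  \<comment> \<open>Compare last symbols. The permutation \<open>elem q' K\<close> ends in
    \<open>1\<close> or \<open>n\<close>, which label no cell, so the transposition must exchange
    the last two positions; the new last symbol is the label of the cell after
    \<open>q'\<close>.\<close>
  have conflict: "elem q i \<noteq> elem q' K \<circ> transpose a (a + 1)"
    if less: "q < 2 * m" "q' < 2 * m" "i < K" and a: "1 \<le> a" "a < N" for q i q' a
  proof
    assume eq: "elem q i = elem q' K \<circ> transpose a (a + 1)"
    have eq_N: "(h ^^ q) N = elem q' K (transpose a (a + 1) N)"
      using fun_cong[OF eq, of N] elem_N[OF less(3), of q] by simp
    show False
    proof (cases "a + 1 = N")
      case False
      then have "transpose a (a + 1) N = N" using a by simp
      then have "(h ^^ q) N = (h ^^ q') n" using eq_N \<pi>_N by (simp add: elem_def)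
      then show False using pow_N_neq[OF less(1)] pow_n[of q'] by simp
    next
      case True
      then have an: "a = n" using nN by simp
      then have "transpose a (a + 1) N = n" using True by simp
      then have "(h ^^ q) N = (h ^^ q') (h N)" using eq_N \<pi>_n h_N by (simp add: elem_def)
      then have step: "(h ^^ q) N = (h ^^ Suc q') N" by (simp add: funpow_swap1)
      have "h ^^ q = h ^^ Suc q'"
      proof (cases "Suc q' = 2 * m")
        case True
        then have "q = 0" using pow_N_inj[of q 0] step period less by simp
        then show ?thesis using True period by (simp only: True) simp
      next
        case False
        then show ?thesis using pow_N_inj[of q "Suc q'"] step less by simp
      qed
      then have "(h ^^ q') (h (vec (g i) x)) = (h ^^ q') (\<pi> (transpose n N x))" for x
        using fun_cong[OF eq, of x] less(3) True an by (simp add: elem_def funpow_swap1)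
      then have "h (vec (g i) x) = \<pi> (transpose n N x)" for x
        using pow_inj[of q'] by (simp add: inj_eq)
      \<comment> \<open>As \<open>h\<close> is \<open>\<pi> \<circ> push_top N id\<close>,
        cancelling \<open>\<pi>\<close> leaves an equation that determines \<open>g i\<close> as the
        omitted \<open>T\<close>-preimage of the identity.\<close>
      then have "\<pi> (push_top N id (vec (g i) x)) = \<pi> (transpose n N x)" for x
        using push_top_comp[of \<pi> N id] by (simp add: h_def fun_eq_iff)
      then have shift: "push_top N id (vec (g i) x) = transpose n N x" for x
        using permutes_inj[OF \<pi>_perm(1)] by (simp add: inj_eq)
      have "g i = [2..<n + 1] @ [1]"
      proof (rule nth_equalityI)
        show "length (g i) = length ([2..<n + 1] @ [1])" using len_g[OF less(3)] nN by simp
        fix k assume "k < length (g i)"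
        then have k: "k < n" using len_g[OF less(3)] by simp
        then have v: "vec (g i) (Suc k) = g i ! k" using len_g[OF less(3)] by (simp add: vec_def)
        have "g i ! k \<in> set (g i)" using k len_g[OF less(3)] by simp
        then have r: "1 \<le> g i ! k" "g i ! k \<le> n" using g(2)[OF less(3)] by auto
        show "g i ! k = ([2..<n + 1] @ [1]) ! k"
        proof (cases "Suc k = n")
          case True
          then have "push_top N id (g i ! k) = N" using shift[of "Suc k"] v by simp
          then have "g i ! k = 1" using r nN by (simp add: push_top_def split: if_splits)
          moreover have "k = length [2..<n + 1]"
            unfolding length_upt using True by linarith
          ultimately show ?thesis by (simp only: nth_append_length)
        next
          case False
          then have "push_top N id (g i ! k) = Suc k" using shift[of "Suc k"] v k nN by simp
          then have "g i ! k = Suc (Suc k)" using r k nN False by (simp add: push_top_def split: if_splits)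
          moreover have "k < length [2..<n + 1]"
            unfolding length_upt using False k by linarith
          then have "([2..<n + 1] @ [1]) ! k = 2 + k"
            using nth_upt[of 2 k "n + 1"] by (simp add: nth_append del: upt_Suc)
          ultimately show ?thesis by simp
        qed
      qed
      then show False using g(3)[OF less(3)] by blast
    qed
  qed
  define M where "M = 2 * m * Suc K"
  \<comment> \<open>Codes are numbered from 1, hence \<open>r - 1\<close>; a cell occupies
    \<open>Suc K\<close> consecutive indices.\<close>
  define c where "c r = elem ((r - 1) div Suc K) ((r - 1) mod Suc K)" for r
  have c_elem: "\<exists>q i. q < 2 * m \<and> i \<le> K \<and> r - 1 = q * Suc K + i \<and> c r = elem q i" if "r \<in> {1..M}" for r
  proof (intro exI conjI)
    show "(r - 1) div Suc K < 2 * m"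
      using that by (intro less_mult_imp_div_less) (auto simp: M_def)
    show "(r - 1) mod Suc K \<le> K" using mod_less_divisor[of "Suc K" "r - 1"] by linarith
    show "r - 1 = (r - 1) div Suc K * Suc K + (r - 1) mod Suc K" by (rule div_mult_mod_eq[symmetric])
  qed (rule c_def)
  have c_idx: "c (Suc (q * Suc K + i)) = elem q i" if "i \<le> K" for q i
  proof -
    have i: "i < Suc K" using that by simp
    have "(i + q * Suc K) div Suc K = q" unfolding div_mult_self1[OF nat.distinct(2)] using i by simp
    moreover have "(i + q * Suc K) mod Suc K = i" unfolding mod_mult_self1 using i by simp
    ultimately have "(q * Suc K + i) div Suc K = q" "(q * Suc K + i) mod Suc K = i"
      by (simp_all only: add.commute)
    then show ?thesis by (simp add: c_def)
  qed
  have gray: "push_top_gray_code N M c"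
    unfolding push_top_gray_code_def
  proof (intro conjI ballI)
    show "c r permutes {1..N}" for r unfolding c_def by (rule elem_perm)
    show "inj_on c {1..M}"
    proof (rule inj_onI)
      fix r r' assume r: "r \<in> {1..M}" "r' \<in> {1..M}" "c r = c r'"
      obtain q i where qi: "q < 2 * m" "i \<le> K" "r - 1 = q * Suc K + i" "c r = elem q i"
        using c_elem[OF r(1)] by blast
      obtain q' i' where qi': "q' < 2 * m" "i' \<le> K" "r' - 1 = q' * Suc K + i'" "c r' = elem q' i'"
        using c_elem[OF r(2)] by blast
      have "q = q' \<and> i = i'" using elem_inj[of q i q' i'] qi qi' r(3) by simp
      then have "r - 1 = r' - 1" using qi qi' by simp
      then show "r = r'" using r(1,2) by auto
    qed
    fix r assume r: "r \<in> {1..M}"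
    obtain q i where qi: "q < 2 * m" "i \<le> K" "r - 1 = q * Suc K + i" "c r = elem q i"
      using c_elem[OF r] by blast
    have r_eq: "r = Suc (q * Suc K + i)" using qi(3) r by auto
    show "\<exists>j. 1 < j \<and> j \<le> N \<and> c (r mod M + 1) = push_top j (c r)"
    proof (cases "i = K")
      case True
      have elem_K: "push_top N (elem q K) = h ^^ Suc q"
        using push_top_comp[of "h ^^ q" N \<pi>] by (simp add: elem_def h_def[symmetric] funpow_Suc_right del: funpow.simps)
      have elem_0: "elem q' 0 = h ^^ q'" for q'
      proof -
        have "elem q' 0 = (h ^^ q') \<circ> vec (g 0)" using K by (simp add: elem_def)
        then show ?thesis unfolding g_0 vec_upt by (simp only: comp_id)
      qed
      have r_K: "r = Suc q * Suc K" using r_eq True by simp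
      have "c (r mod M + 1) = h ^^ Suc q"
      \<comment> \<open>Behind the last cell the code wraps around: there \<open>h ^^ Suc q\<close>
        is the identity by \<open>period\<close>, which is the first element.\<close>
      proof (cases "Suc q = 2 * m")
        case True
        then have "r mod M = 0" unfolding r_K M_def by simp
        then have "c (r mod M + 1) = elem 0 0" using c_idx[of 0 0] by simp
        then show ?thesis unfolding elem_0 True period by simp
      next
        case False
        then have "Suc q < 2 * m" using qi by simp
        then have "r < M" unfolding r_K M_def by (intro mult_strict_right_mono) auto
        then have "c (r mod M + 1) = c (Suc (Suc q * Suc K + 0))" unfolding r_K by simp
        also have "\<dots> = elem (Suc q) 0" by (rule c_idx) simp
        finally show ?thesis unfolding elem_0 .
      qed
      then show ?thesis using elem_K qi(4) True nN by (intro exI[of _ N]) auto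
    next
      case False
      then have i: "i < K" using qi by simp
      have "r < M"
      proof -
        have "r < Suc q * Suc K" using r_eq i by simp
        also have "\<dots> \<le> M" unfolding M_def using qi(1) by (intro mult_right_mono) auto
        finally show ?thesis .
      qed
      then have "c (r mod M + 1) = c (Suc (q * Suc K + Suc i))" using r_eq by simp
      also have "\<dots> = elem q (Suc i)" by (rule c_idx) (use i in simp)
      finally have c_next: "c (r mod M + 1) = elem q (Suc i)" .
      show ?thesis
      proof (cases "Suc i < K")
        case True
        obtain j where "1 < j" "j \<le> N" "vec (g (Suc i)) = push_top j (vec (g i))"
          using vec_Suc[OF True] by blast
        then show ?thesis
          using c_next qi(4) i True push_top_comp[of "h ^^ q" j "vec (g i)"]
          by (intro exI[of _ j]) (simp add: elem_def)
      next
        case False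
        then have "i = K - 1" using i by simp
        then have "elem q (Suc i) = push_top N (elem q i)"
          using push_top_comp[of "h ^^ q" N e] K by (simp add: elem_def \<pi>_def e_def)
        then show ?thesis using c_next qi(4) nN by (intro exI[of _ N]) auto
      qed
    qed
  qed
  have snake: "kendall_snake N M c"
    unfolding kendall_snake_def
  proof (intro conjI ballI impI gray)
    fix \<sigma> \<tau> assume \<sigma>\<tau>: "\<sigma> \<in> c ` {1..M}" "\<tau> \<in> c ` {1..M}" "\<sigma> \<noteq> \<tau>"
    obtain q i where \<sigma>: "q < 2 * m" "i \<le> K" "\<sigma> = elem q i" using c_elem \<sigma>\<tau>(1) by blast
    obtain q' i' where \<tau>: "q' < 2 * m" "i' \<le> K" "\<tau> = elem q' i'" using c_elem \<sigma>\<tau>(2) by blast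
    have perms: "\<sigma> permutes {1..N}" "\<tau> permutes {1..N}"
      unfolding \<sigma>(3) \<tau>(3) by (rule elem_perm)+
    \<comment> \<open>An adjacent transposition flips the parity, so one of the two permutations is
      at index \<open>K\<close> of its cell and the other on a path; this is the case of
      \<open>conflict\<close>.\<close>
    have "\<sigma> \<noteq> \<tau> \<circ> transpose a (a + 1)" if a: "a \<in> {1..<N}" for a
    proof
      assume eq: "\<sigma> = \<tau> \<circ> transpose a (a + 1)"
      have eq': "\<tau> = \<sigma> \<circ> transpose a (a + 1)" unfolding eq by (simp add: o_assoc[symmetric])
      have t: "transpose a (a + 1) permutes {1..N}" using a by (intro permutes_swap_id) auto
      have "\<not> evenperm (transpose a (a + 1))" by (simp add: evenperm_swap)
      then have "evenperm \<sigma> \<noteq> evenperm \<tau>"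
        using evenperm_permutes_comp[OF finite_atLeastAtMost perms(2) t] unfolding eq by blast
      then have "(i < K) \<noteq> (i' < K)" using elem_even \<sigma> \<tau> by simp
      then consider "i < K" "i' = K" | "i = K" "i' < K" using \<sigma>(2) \<tau>(2) by linarith
      then show False
      proof cases
        case 1
        then show False using conflict[OF \<sigma>(1) \<tau>(1), of i a] eq a \<sigma> \<tau> by auto
      next
        case 2
        then show False using conflict[OF \<tau>(1) \<sigma>(1), of i' a] eq' a \<sigma> \<tau> by auto
      qed
    qed
    then show "2 \<le> kendall_dist N \<sigma> \<tau>"
      using kendall_dist_ge_2_iff[OF perms \<sigma>\<tau>(3)] by blast
  qed
  \<comment> \<open>A cell has \<open>K + 1 = n!/2 - (2m - 2)\<close> elements, and the factor
    \<open>2m + 2\<close> of \<open>(2m + 2)!\<close> cancels the denominator.\<close>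
  have "real M = real (2 * m) / real (2 * m + 2) * (fact (2 * m + 2) / 2) - (2 * real m - 2) * (2 * real m)"
  proof -
    have "2 dvd (fact n :: nat)" using nN by (intro dvd_fact) auto
    then have "real (fact n div 2) = fact n / 2" by (simp add: real_of_nat_div)
    then have real_K: "real K = fact n / 2 - (2 * real m - 1)"
      using K_less assms by (simp add: K_def n_def)
    have "real M = 2 * real m * (real K + 1)" by (simp add: M_def algebra_simps)
    then have "real M = 2 * real m * (fact n / 2 - (2 * real m - 2))" unfolding real_K by simp
    moreover have "real (2 * m) / real (2 * m + 2) * (fact (2 * m + 2) / 2) = real m * fact n"
    proof -
      define d where "d = real (2 * m + 2)"
      have "d \<noteq> 0" by (simp add: d_def)
      moreover have "fact (2 * m + 2) = d * fact n"
        using fact_Suc[of n, where 'a = real] by (simp add: n_def d_def)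
      ultimately show ?thesis unfolding d_def[symmetric] by simp
    qed
    ultimately show ?thesis by (simp add: algebra_simps)
  qed
  with snake show ?thesis unfolding N_def by blast
qed

end
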